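(* Let $1\le p\le\infty$. For all $\mathcal{A}_1,\mathcal{A}_2,\mathcal{B}_1,\mathcal{B}_2\in\mathbb{R}^{n_1\times n_1\times n_3}$, $$2^{-|\frac1p-\frac12|}\big\|\,|\mathcal{A}_1+\mathcal{A}_2|^p+|\mathcal{B}_1+\mathcal{B}_2|^p\,\big\|^{1/p}\le\big\|\,|\mathcal{A}_1|^p+|\mathcal{B}_1|^p\,\big\|^{1/p}+\big\|\,|\mathcal{A}_2|^p+|\mathcal{B}_2|^p\,\big\|^{1/p}$$ holds both for $\|\cdot\|$ the Frobenius norm $\|\cdot\|_F$ and for $\|\cdot\|$ the spectral norm $\|\cdot\|_2$.
   Context: For $\mathcal{A}\in\mathbb{R}^{n_1\times n_2\times n_3}$ with frontal slices $A^{(1)},\dots,A^{(n_3)}$ (each $n_1\times n_2$), $\mathrm{bcirc}(\mathcal{A})$ is the $n_1n_3\times n_2n_3$ block circulant matrix whose first block column is $A^{(1)},A^{(2)},\dots,A^{(n_3)}$ (top to bottom), i.e. its $(i,j)$ block is $A^{(((i-j)\bmod n_3)+1)}$. $\mathrm{unfold}(\mathcal{A})$ is the first block column of $\mathrm{bcirc}(\mathcal{A})$ and $\mathrm{fold}$ is its inverse. The t-product of $\mathcal{A}\in\mathbb{R}^{n_1\times n_2\times n_3}$ and $\mathcal{B}\in\mathbb{R}^{n_2\times n_4\times n_3}$ is $\mathcal{A}*\mathcal{B}=\mathrm{fold}(\mathrm{bcirc}(\mathcal{A})\cdot\mathrm{unfold}(\mathcal{B}))\in\mathbb{R}^{n_1\times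 n_4\times n_3}$. The transpose $\mathcal{A}^{T}$ is obtained by transposing each frontal slice and reversing the order of the transposed slices $2,\dots,n_3$; $\mathcal{A}$ is symmetric if $\mathcal{A}^T=\mathcal{A}$. The inner product is $\langle\mathcal{X},\mathcal{Y}\rangle=\sum_{i,j,k}x_{ijk}y_{ijk}$. A tensor $\mathcal{A}\in\mathbb{R}^{n\times n\times n_3}$ is symmetric t-positive semidefinite, written $\mathcal{A}\ge0$, if it is symmetric and $\langle\mathcal{X},\mathcal{A}*\mathcal{X}\rangle\ge0$ for all nonzero $\mathcal{X}\in\mathbb{R}^{n\times1\times n_3}$. For $\mathcal{A}\ge0$ and a real number $r>0$, the power $\mathcal{A}^r$ (a tensor t-function) is the tensor with $\mathrm{bcirc}(\mathcal{A}^r)=(\mathrm{bcirc}(\mathcal{A}))^r$, the usual power of a positive semidefinite matrix. For any $\mathcal{A}\in\mathbb{R}^{n\times n\times n_3}$, $|\mathcal{A}|=(\mathcal{A}^T*\mathcal{A})^{1/2}$, which is symmetric t-positive semidefinite. Norms: $\|\mathcal{A}\|_F=\sqrt{\sum_{i,j,k}|a_{ijk}|^2}$ and $\|\mathcal{A}\|_2=\|\mathrm{bcirc}(\mathcal{A})\|_2$ (matrix spectral norm). Convention: $1/\infty=0$, and for $p=\infty$, $\|\,|\mathcal{A}|^p+|\mathcal{B}|^p\,\|^{1/p}$ denotes its limit as $p\to\infty$, namely $\max(\|\mathcal{A}\|_2,\|\mathcal{B}\|_2)$ (for either norm). *)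

theory Defs
  imports "HOL-Library.Extended_Real" "Jordan_Normal_Form.Matrix"
begin

text \<open>A tensor is the list of its frontal slices, so slices are counted from 0 and the number
  of slices is the length of the list. The first two dimensions are read off the first slice,
  which is meaningful only when there is at least one slice.\<close>

type_synonym tensor = "real mat list"

definition tensor_carrier :: "nat \<Rightarrow> nat \<Rightarrow> nat \<Rightarrow> tensor set" where
  "tensor_carrier n1 n2 n3 = {A. length A = n3 \<and> set A \<subseteq> carrier_mat n1 n2}"

abbreviation t_rows :: "tensor \<Rightarrow> nat" where "t_rows A \<equiv> dim_row (hd A)"
abbreviation t_cols :: "tensor \<Rightarrow> nat" where "t_cols A \<equiv> dim_col (hd A)"

definition t_add :: "tensor \<Rightarrow> tensor \<Rightarrow> tensor" (infixl "+\<^sub>t" 65) where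
  "A +\<^sub>t B = map2 (+) A B"

definition bcirc :: "tensor \<Rightarrow> real mat" where
  "bcirc A = mat (t_rows A * length A) (t_cols A * length A)
     (\<lambda>(i, j). (A ! nat ((int (i div t_rows A) - int (j div t_cols A)) mod int (length A)))
        $$ (i mod t_rows A, j mod t_cols A))"

definition t_unfold :: "tensor \<Rightarrow> real mat" where
  "t_unfold A = mat (t_rows A * length A) (t_cols A)
     (\<lambda>(i, j). (A ! (i div t_rows A)) $$ (i mod t_rows A, j))"

definition t_fold :: "nat \<Rightarrow> real mat \<Rightarrow> tensor" where
  "t_fold n3 M = (let m = dim_row M div n3 in
     map (\<lambda>k. mat m (dim_col M) (\<lambda>(i, j). M $$ (k * m + i, j))) [0..<n3])"

lemma t_unfold_eq_first_block_column:
  assumes "A \<in> tensor_carrier n1 n2 n3" "n1 > 0" "n2 > 0" "n3 > 0"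
  shows "t_unfold A = mat (n1 * n3) n2 (\<lambda>(i, j). bcirc A $$ (i, j))"
proof -
  have "hd A \<in> set A" using assms by (cases A) (auto simp: tensor_carrier_def)
  then have d: "t_rows A = n1" "t_cols A = n2" "length A = n3"
    using assms by (auto simp: tensor_carrier_def)
  have "i div n1 < n3" if "i < n1 * n3" for i
    using that by (simp add: less_mult_imp_div_less mult.commute)
  moreover have "j < n2 * n3" if "j < n2" for j
    using that assms by (metis Suc_leI less_le_trans mult.right_neutral mult_le_mono2 One_nat_def)
  ultimately show ?thesis
    using assms by (intro eq_matI) (auto simp: t_unfold_def bcirc_def d simp flip: zmod_int)
qed

lemma t_fold_t_unfold:
  assumes "A \<in> tensor_carrier n1 n2 n3" "n1 > 0" "n3 > 0"
  shows "t_fold n3 (t_unfold A) = A"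
proof -
  have "hd A \<in> set A" using assms by (cases A) (auto simp: tensor_carrier_def)
  then have d: "t_rows A = n1" "t_cols A = n2" "length A = n3"
    using assms by (auto simp: tensor_carrier_def)
  have c: "A ! k \<in> carrier_mat n1 n2" if "k < n3" for k
    using that assms by (auto simp: tensor_carrier_def)
  have b: "k * n1 + i < n1 * n3" if "k < n3" "i < n1" for k i
  proof -
    have "k * n1 + i < Suc k * n1" using that by simp
    also have "\<dots> \<le> n3 * n1" using that by (intro mult_le_mono1) simp
    finally show ?thesis by (simp add: mult.commute)
  qed
  show ?thesis
  proof (rule nth_equalityI)
    show "length (t_fold n3 (t_unfold A)) = length A" by (simp add: t_fold_def d Let_def)
    fix k assume "k < length (t_fold n3 (t_unfold A))"
    then have k: "k < n3" by (simp add: t_fold_def Let_def)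
    show "t_fold n3 (t_unfold A) ! k = A ! k"
      using k c[OF k] b[OF k] assms
      by (intro eq_matI) (auto simp: t_fold_def t_unfold_def d Let_def)
  qed
qed

definition t_prod :: "tensor \<Rightarrow> tensor \<Rightarrow> tensor" (infixl "*\<^sub>t" 70) where
  "A *\<^sub>t B = t_fold (length A) (bcirc A * t_unfold B)"

definition t_transpose :: "tensor \<Rightarrow> tensor" where
  "t_transpose A = map transpose_mat (take 1 A @ rev (drop 1 A))"

text \<open>The power of a positive semidefinite matrix, through an orthogonal diagonalization with
  nonnegative eigenvalues. It is meant for \<open>r > 0\<close>; note \<open>0 powr r = 0\<close>.
  The description does not depend on the diagonalization, see \<open>psd_power_unique\<close> below.\<close>

definition is_psd_power :: "real mat \<Rightarrow> real \<Rightarrow> real mat \<Rightarrow> bool" where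
  "is_psd_power M r P \<longleftrightarrow> (let n = dim_row M in
     \<exists>U d. U \<in> carrier_mat n n \<and> U * transpose_mat U = 1\<^sub>m n \<and> transpose_mat U * U = 1\<^sub>m n \<and>
       (\<forall>i<n. 0 \<le> d i) \<and>
       M = U * mat_diag n d * transpose_mat U \<and>
       P = U * mat_diag n (\<lambda>i. d i powr r) * transpose_mat U)"

lemma psd_power_unique:
  assumes "is_psd_power M r P" "is_psd_power M r Q"
  shows "P = Q"
proof -
  define n where "n = dim_row M"
  let ?T = "\<lambda>d r. mat_diag n (\<lambda>i. d i powr r)"
  obtain U d where U: "U \<in> carrier_mat n n" "U * transpose_mat U = 1\<^sub>m n" "transpose_mat U * U = 1\<^sub>m n"
    and MU: "M = U * mat_diag n d * transpose_mat U" and PU: "P = U * ?T d r * transpose_mat U"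
    using assms(1) unfolding is_psd_power_def n_def Let_def by blast
  obtain V e where V: "V \<in> carrier_mat n n" "V * transpose_mat V = 1\<^sub>m n" "transpose_mat V * V = 1\<^sub>m n"
    and MV: "M = V * mat_diag n e * transpose_mat V" and QV: "Q = V * ?T e r * transpose_mat V"
    using assms(2) unfolding is_psd_power_def n_def Let_def by blast
  define W where "W = transpose_mat V * U"
  note [simp] = U V assoc_mult_mat[of _ n n _ n _ n] mult_carrier_mat[of _ n n _ n] left_mult_one_mat[of _ n n] right_mult_one_mat[of _ n n]
  have [simp]: "transpose_mat U \<in> carrier_mat n n" "transpose_mat V \<in> carrier_mat n n"
    using U(1) V(1) by auto
  have W[simp]: "W \<in> carrier_mat n n" by (simp add: W_def)
  have sandwich: "transpose_mat V * (U * X * transpose_mat U) * U = W * X"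
    "transpose_mat V * (V * X * transpose_mat V) * U = X * W" 
    if [simp]: "X \<in> carrier_mat n n" for X
  proof -
    have "transpose_mat V * (V * X * transpose_mat V) * U
        = (transpose_mat V * V) * (X * (transpose_mat V * U))"
      by (simp del: V(3))
    then show "transpose_mat V * (V * X * transpose_mat V) * U = X * W" by (simp add: W_def)
  qed (simp add: W_def)
  have "W * mat_diag n d = mat_diag n e * W"
    using sandwich(1)[of "mat_diag n d"] sandwich(2)[of "mat_diag n e"]
    unfolding MU[symmetric] MV[symmetric] by (metis mat_diag_dim)
  then have entry: "W $$ (i, j) * d j = e i * W $$ (i, j)" if "i < n" "j < n" for i j
    using that by (auto simp: mat_diag_mult_left[OF W] mat_diag_mult_right[OF W] mat_eq_iff)
  have "W $$ (i, j) * (d j powr r) = (e i powr r) * W $$ (i, j)" if "i < n" "j < n" for i j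
    using entry[OF that] by (cases "W $$ (i, j) = 0") auto
  then have WT: "W * ?T d r = ?T e r * W"
    by (auto simp: mat_diag_mult_left[OF W] mat_diag_mult_right[OF W] mat_eq_iff)
  have "V * W = (V * transpose_mat V) * U" by (simp add: W_def del: V(2))
  then have VW: "V * W = U" using U V by (metis left_mult_one_mat)
  have "W * transpose_mat U = transpose_mat V * (U * transpose_mat U)" by (simp add: W_def del: U(2))
  then have WU: "W * transpose_mat U = transpose_mat V"
    using U V by (metis right_mult_one_mat transpose_carrier_mat)
  have "P = (V * W) * ?T d r * transpose_mat U" unfolding PU VW ..
  also have "\<dots> = V * (W * ?T d r) * transpose_mat U" by simp
  also have "\<dots> = V * ?T e r * (W * transpose_mat U)" unfolding WT by simp
  finally show ?thesis unfolding WU QV .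
qed

definition mat_powr :: "real mat \<Rightarrow> real \<Rightarrow> real mat" where
  "mat_powr M r = (THE P. is_psd_power M r P)"

definition t_powr :: "tensor \<Rightarrow> real \<Rightarrow> tensor" (infixr "powr\<^sub>t" 80) where
  "A powr\<^sub>t r = (THE B. B \<in> tensor_carrier (t_rows A) (t_cols A) (length A) \<and>
                     bcirc B = mat_powr (bcirc A) r)"

definition t_abs :: "tensor \<Rightarrow> tensor" where
  "t_abs A = (t_transpose A *\<^sub>t A) powr\<^sub>t (1/2)"

definition frob_norm :: "tensor \<Rightarrow> real" where
  "frob_norm A = sqrt (\<Sum>k<length A. \<Sum>i<t_rows A. \<Sum>j<t_cols A. \<bar>(A ! k) $$ (i, j)\<bar>\<^sup>2)"

definition mat_spectral_norm :: "real mat \<Rightarrow> real" where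
  "mat_spectral_norm M =
     Sup {sqrt ((M *\<^sub>v x) \<bullet> (M *\<^sub>v x)) | x. x \<in> carrier_vec (dim_col M) \<and> x \<bullet> x = 1}"

definition spec_norm :: "tensor \<Rightarrow> real" where
  "spec_norm A = mat_spectral_norm (bcirc A)"

definition power_sum_norm :: "(tensor \<Rightarrow> real) \<Rightarrow> real \<Rightarrow> tensor \<Rightarrow> tensor \<Rightarrow> real" where
  "power_sum_norm N p A B = N (t_abs A powr\<^sub>t p +\<^sub>t t_abs B powr\<^sub>t p) powr (1 / p)"

text \<open>Extension to \<open>p = \<infinity>\<close> by the limit. For both norms above that limit exists and equals
  \<open>max (spec_norm A) (spec_norm B)\<close>.\<close>

definition power_sum_norm_ext :: "(tensor \<Rightarrow> real) \<Rightarrow> ereal \<Rightarrow> tensor \<Rightarrow> tensor \<Rightarrow> real" where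
  "power_sum_norm_ext N p A B =
     (if p = \<infinity> then Lim at_top (\<lambda>q. power_sum_norm N q A B)
      else power_sum_norm N (real_of_ereal p) A B)"

end

theory Submission
  imports Defs "Jordan_Normal_Form.Spectral_Radius" "HOL-Analysis.Convex" "HOL-Analysis.L2_Norm"
begin

text \<open>
  The map \<open>bcirc\<close> turns the algebra of tensors into the algebra of block circulant matrices, so the
  claim is one about matrices, with the spectral norm unchanged and the Frobenius norm rescaled
  by a constant. Put \<open>r = p / 2\<close>, let \<open>S = M\<^sup>T M\<close> and \<open>T = N\<^sup>T N\<close> for \<open>M = bcirc A\<close> and
  \<open>N = bcirc B\<close>, and let \<open>Z = S + T\<close>. The quantity to be estimated is \<open>\<parallel>S\<^sup>r + T\<^sup>r\<parallel>\<close>; the one that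
  behaves well is \<open>\<parallel>Z\<^sup>r\<parallel>\<close>, because \<open>\<langle>x, Z x\<rangle>\<close> is the squared length of the
  stacked vector \<open>(M x, N x)\<close>, whose length is subadditive in \<open>(M, N)\<close>.

  The map \<open>(A, B) \<mapsto> \<parallel>Z\<^sup>r\<parallel>\<^bsup>1/p\<^esup>\<close> is subadditive (\<open>modulus_triangle\<close>): evaluate the subadditive
  lengths at the eigenvectors of the \<open>Z\<close> belonging to the sum, apply Minkowski's inequality to the
  eigenvalues, and return to the two summands by Jensen's inequality. The two quantities are
  compared by
  \<^item> \<open>\<parallel>S\<^sup>r + T\<^sup>r\<parallel> \<le> \<parallel>Z\<^sup>r\<parallel> \<le> 2\<^bsup>r-1\<^esup> \<parallel>S\<^sup>r + T\<^sup>r\<parallel>\<close> for \<open>r \<ge> 1\<close>,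
  \<^item> \<open>\<parallel>Z\<^sup>r\<parallel> \<le> \<parallel>S\<^sup>r + T\<^sup>r\<parallel> \<le> 2\<^bsup>1-r\<^esup> \<parallel>Z\<^sup>r\<parallel>\<close> for \<open>1/2 \<le> r \<le> 1\<close>.

  In both ranges the product of the two constants, raised to the power \<open>1/p\<close>, is
  \<open>2\<^bsup>|1/p - 1/2|\<^esup>\<close>. The bounds with a power of two are convexity of \<open>t \<mapsto> t\<^bsup>s\<^esup>\<close> on two points
  (\<open>sum_powr_le_power_sum\<close>, \<open>power_sum_le_sum_powr\<close>). The other two are the substance of
  the proof. They are easy for the largest eigenvalue (\<open>spectral_gauge_Max\<close>). For the Frobenius norm
  (\<open>power_sum_frobenius_le\<close>, \<open>power_sum_frobenius_ge\<close>) all traces are written as double sums over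
  pairs of eigenvectors with the nonnegative weights \<open>\<langle>u\<^sub>i, v\<^sub>j\<rangle>\<^sup>2\<close>, which reduces them to scalar
  inequalities, to Jensen's inequality and to a weak form of operator monotonicity
  (\<open>powr_eigenvalue_le_diag_form\<close>).

  For \<open>p = \<infinity>\<close> the inequality is the limit of the finite ones; the limits exist because the norm is
  within constant factors of the \<open>p\<close>-th power of the largest singular value, and the \<open>p\<close>-th roots
  of the constants tend to 1 (\<open>power_sum_norm_tendsto\<close>).
\<close>

unbundle no inner_syntax

section \<open>The spectral theorem for real symmetric matrices\<close>

text \<open>A complex eigenvector \<open>x + i y\<close> exists. Symmetry gives \<open>\<langle>A y, x\<rangle> = \<langle>y, A x\<rangle>\<close>, which forces
  the eigenvalue to be real, so that \<open>x\<close> and \<open>y\<close> both satisfy the eigenvector equation, and one of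
  them is not zero.\<close>

lemma symmetric_mat_real_eigenvector:
  fixes A :: "real mat"
  assumes A: "A \<in> carrier_mat n n" and n: "n > 0" and sym: "transpose_mat A = A"
  shows "\<exists>v e. v \<in> carrier_vec n \<and> v \<bullet> v = 1 \<and> A *\<^sub>v v = e \<cdot>\<^sub>v v"
proof -
  let ?C = "map_mat complex_of_real A"
  have C: "?C \<in> carrier_mat n n" using A by simp
  obtain l where "eigenvalue ?C l"
    using spectrum_non_empty[OF C] n by (auto simp: spectrum_def)
  then obtain z where z: "z \<in> carrier_vec n" "z \<noteq> 0\<^sub>v n" "?C *\<^sub>v z = l \<cdot>\<^sub>v z"
    using C by (auto simp: eigenvalue_def eigenvector_def)
  define x where "x = map_vec Re z"
  define y where "y = map_vec Im z"
  have xy[simp]: "x \<in> carrier_vec n" "y \<in> carrier_vec n" using z by (auto simp: x_def y_def)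
  have [simp]: "dim_vec x = n" "dim_vec y = n" using xy by auto
  have row: "(\<Sum>j<n. complex_of_real (A $$ (i, j)) * z $ j) = l * z $ i" if "i < n" for i
  proof -
    have "(?C *\<^sub>v z) $ i = (\<Sum>j<n. complex_of_real (A $$ (i, j)) * z $ j)"
      using that A z(1) by (auto simp: scalar_prod_def lessThan_atLeast0)
    then show ?thesis using that z(1) by (simp add: z(3))
  qed
  have Ax: "A *\<^sub>v x = Re l \<cdot>\<^sub>v x - Im l \<cdot>\<^sub>v y"
  proof (rule eq_vecI)
    fix i assume "i < dim_vec (Re l \<cdot>\<^sub>v x - Im l \<cdot>\<^sub>v y)"
    then have i: "i < n" using xy by (simp add: y_def z carrier_vecD[OF z(1)])
    show "(A *\<^sub>v x) $ i = (Re l \<cdot>\<^sub>v x - Im l \<cdot>\<^sub>v y) $ i"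
      using arg_cong[OF row[OF i], of Re] i A z
      by (auto simp: scalar_prod_def lessThan_atLeast0 x_def y_def)
  qed (use A xy in auto)
  have Ay: "A *\<^sub>v y = Im l \<cdot>\<^sub>v x + Re l \<cdot>\<^sub>v y"
  proof (rule eq_vecI)
    fix i assume "i < dim_vec (Im l \<cdot>\<^sub>v x + Re l \<cdot>\<^sub>v y)"
    then have i: "i < n" using xy by (simp add: y_def z carrier_vecD[OF z(1)])
    show "(A *\<^sub>v y) $ i = (Im l \<cdot>\<^sub>v x + Re l \<cdot>\<^sub>v y) $ i"
      using arg_cong[OF row[OF i], of Im] i A z
      by (auto simp: scalar_prod_def lessThan_atLeast0 x_def y_def algebra_simps)
  qed (use A xy in auto)
  have "(A *\<^sub>v y) \<bullet> x = y \<bullet> (A *\<^sub>v x)"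
    using transpose_vec_mult_scalar[OF A xy] sym by simp
  then have "Im l * (x \<bullet> x + y \<bullet> y) = 0"
    unfolding Ax Ay using xy
    by (simp add: add_scalar_prod_distrib[of _ n] scalar_prod_minus_distrib[of _ n]
        comm_scalar_prod[of y n x] algebra_simps)
  moreover have pos: "x \<bullet> x + y \<bullet> y > 0"
  proof -
    obtain i where i: "i < n" "z $ i \<noteq> 0" using z by (metis carrier_vecD eq_vecI index_zero_vec)
    have "0 < (Re (z $ i))\<^sup>2 + (Im (z $ i))\<^sup>2" 
      using i(2) by (simp add: complex_eq_iff sum_power2_gt_zero_iff)
    also have "\<dots> \<le> (\<Sum>i<n. (Re (z $ i))\<^sup>2 + (Im (z $ i))\<^sup>2)"
      by (rule member_le_sum) (use i in auto)
    also have "\<dots> = x \<bullet> x + y \<bullet> y"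
      using z by (auto simp: scalar_prod_def lessThan_atLeast0 x_def y_def sum.distrib power2_eq_square)
    finally show ?thesis .
  qed
  ultimately have "Im l = 0" by simp
  then have eig: "A *\<^sub>v x = Re l \<cdot>\<^sub>v x" "A *\<^sub>v y = Re l \<cdot>\<^sub>v y"
    using Ax Ay xy by (auto intro!: eq_vecI)
  obtain w where w: "w \<in> carrier_vec n" "w \<bullet> w > 0" "A *\<^sub>v w = Re l \<cdot>\<^sub>v w"
    using eig xy pos by (cases "x \<bullet> x > 0") force+
  define v where "v = (1 / sqrt (w \<bullet> w)) \<cdot>\<^sub>v w"
  have "v \<in> carrier_vec n" "v \<bullet> v = 1" "A *\<^sub>v v = Re l \<cdot>\<^sub>v v"
    using w A by (auto simp: v_def mult_mat_vec smult_smult_assoc mult.commute 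
        real_sqrt_mult[symmetric] field_simps)
  then show ?thesis by blast
qed

text \<open>The reflection that exchanges \<open>v\<close> and the first basis vector serves as the change of basis in the
  induction step of the spectral theorem: it is its own transpose and its own inverse.\<close>

lemma householder_reflection:
  fixes v :: "real vec"
  assumes v: "v \<in> carrier_vec n" "v \<bullet> v = 1" and n: "n > 0"
  shows "\<exists>W. W \<in> carrier_mat n n \<and> transpose_mat W = W \<and> W * W = 1\<^sub>m n \<and> col W 0 = v"
proof -
  define w where "w = v - unit_vec n 0"
  have wi: "w $ i = v $ i - (if i = 0 then 1 else 0)" if "i < n" for i
    using that v n by (simp add: w_def)
  have wc: "w \<in> carrier_vec n" by (simp add: w_def v)
  have ww: "w \<bullet> w = 2 - 2 * v $ 0"
  proof -
    have "w \<bullet> w = v \<bullet> v - v $ 0 - v $ 0 + 1"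
      unfolding w_def using v n
      by (simp add: minus_scalar_prod_distrib[of _ n] scalar_prod_minus_distrib[of _ n])
    then show ?thesis using v by simp
  qed
  show ?thesis
  proof (cases "w \<bullet> w = 0")
    case True
    then have "w = 0\<^sub>v n"
      using wc by (intro eq_vecI) (auto simp: scalar_prod_def sum_nonneg_eq_0_iff)
    then have "col (1\<^sub>m n) 0 = v" using wi n v by (intro eq_vecI) (auto)
    then show ?thesis by (intro exI[of _ "1\<^sub>m n"]) auto
  next
    case False
    define c where "c = 2 / (w \<bullet> w)"
    define W where "W = mat n n (\<lambda>(i, j). (if i = j then 1 else 0) - c * w $ i * w $ j)"
    have "W * W = 1\<^sub>m n"
    proof (rule eq_matI)
      fix i j assume "i < dim_row (1\<^sub>m n :: real mat)" "j < dim_col (1\<^sub>m n :: real mat)"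
      then have ij: "i < n" "j < n" by auto
      have "(W * W) $$ (i, j) = (\<Sum>k<n. ((if i = k then 1 else 0) - c * w $ i * w $ k) *
          ((if k = j then 1 else 0) - c * w $ k * w $ j))"
        using ij by (simp add: W_def scalar_prod_def lessThan_atLeast0)
      also have "\<dots> = (\<Sum>k<n. (if i = k then (if i = j then 1 else 0) - c * w $ i * w $ j else 0)
         - (if k = j then c * w $ i * w $ j else 0) + c\<^sup>2 * w $ i * w $ j * (w $ k * w $ k))"
        by (rule sum.cong) (auto simp: power2_eq_square algebra_simps)
      also have "\<dots> = (if i = j then 1 else 0) - 2 * c * w $ i * w $ j
          + c\<^sup>2 * w $ i * w $ j * (w \<bullet> w)"
        using ij wc by (simp add: sum.distrib sum_subtractf sum_distrib_left[symmetric] 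
            scalar_prod_def lessThan_atLeast0)
      also have "c\<^sup>2 * w $ i * w $ j * (w \<bullet> w) = 2 * c * w $ i * w $ j"
        using False by (simp add: c_def power2_eq_square)
      finally show "(W * W) $$ (i, j) = 1\<^sub>m n $$ (i, j)" using ij by simp
    qed (auto simp: W_def)
    moreover have "col W 0 = v"
    proof (rule eq_vecI)
      fix i assume "i < dim_vec v"
      then have i: "i < n" using v by auto
      have "c * w $ 0 = -1" using False n by (simp add: c_def wi ww field_simps)
      then have "c * w $ i * w $ 0 = - w $ i" by (metis mult.assoc mult.commute mult_minus1)
      then show "col W 0 $ i = v $ i" using i n by (auto simp: W_def wi)
    qed (use v in \<open>auto simp: W_def\<close>)
    ultimately show ?thesis by (intro exI[of _ W]) (auto simp: W_def intro!: eq_matI)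
  qed
qed

text \<open>Conjugating by the reflection that moves a unit eigenvector to the first basis vector splits off
  a 1 by 1 block; symmetry clears the rest of the first row, and the remaining block is smaller.\<close>

theorem real_spectral_theorem:
  fixes S :: "real mat"
  assumes "S \<in> carrier_mat n n" "transpose_mat S = S"
  shows "\<exists>U d. U \<in> carrier_mat n n \<and> U * transpose_mat U = 1\<^sub>m n \<and> transpose_mat U * U = 1\<^sub>m n \<and>
    S = U * mat_diag n d * transpose_mat U"
  using assms
proof (induction n arbitrary: S)
  case 0
  then show ?case by (intro exI[of _ "1\<^sub>m 0"] exI[of _ "\<lambda>_. 0"]) auto
next
  case (Suc n)
  let ?N = "Suc n"
  obtain v e where v: "v \<in> carrier_vec ?N" "v \<bullet> v = 1" "S *\<^sub>v v = e \<cdot>\<^sub>v v"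
    using symmetric_mat_real_eigenvector[OF Suc.prems(1) _ Suc.prems(2)] by auto
  obtain W where W: "W \<in> carrier_mat ?N ?N" "transpose_mat W = W" "W * W = 1\<^sub>m ?N" "col W 0 = v"
    using householder_reflection[OF v(1,2)] by auto
  note S = Suc.prems
  note [simp] = assoc_mult_mat[of _ ?N ?N _ ?N _ ?N] mult_carrier_mat[of _ ?N ?N _ ?N]
    left_mult_one_mat[of _ ?N ?N] right_mult_one_mat[of _ ?N ?N]
  define B where "B = W * S * W"
  have B: "B \<in> carrier_mat ?N ?N" using W S by (simp add: B_def)
  have symB: "transpose_mat B = B"
    using W S by (simp add: B_def transpose_mult[of _ ?N ?N _ ?N])
  have "col B 0 = e \<cdot>\<^sub>v unit_vec ?N 0"
  proof -
    have "col B 0 = W *\<^sub>v (S *\<^sub>v col W 0)"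
      using W S by (simp add: B_def col_mult2[of _ ?N ?N _ ?N])
    also have "\<dots> = e \<cdot>\<^sub>v (W *\<^sub>v col W 0)" using W S v by (simp add: mult_mat_vec)
    also have "W *\<^sub>v col W 0 = col (W * W) 0" using W(1) by (simp add: col_mult2[of _ ?N ?N _ ?N])
    also have "\<dots> = unit_vec ?N 0" by (simp add: W(3))
    finally show ?thesis .
  qed
  then have colB: "col B 0 $ i = (if i = 0 then e else 0)" if "i < ?N" for i
    using that by simp
  have B0: "B $$ (i, 0) = (if i = 0 then e else 0)" if "i < ?N" for i
    using colB[OF that] that B by simp
  have B0': "B $$ (0, i) = (if i = 0 then e else 0)" if "i < ?N" for i
    using B0[OF that] symB B that by (metis carrier_matD index_transpose_mat(1) zero_less_Suc)
  define S' where "S' = mat n n (\<lambda>(i, j). B $$ (Suc i, Suc j))"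
  have "transpose_mat S' = S'"
  proof (rule eq_matI)
    fix i j assume "i < dim_row S'" "j < dim_col S'"
    then show "transpose_mat S' $$ (i, j) = S' $$ (i, j)"
      using B arg_cong[OF symB, of "\<lambda>M. M $$ (Suc i, Suc j)"] by (simp add: S'_def)
  qed (auto simp: S'_def)
  then obtain U d where U: "U \<in> carrier_mat n n" "U * transpose_mat U = 1\<^sub>m n"
    "transpose_mat U * U = 1\<^sub>m n" and S': "S' = U * mat_diag n d * transpose_mat U"
    using Suc.IH[of S'] by (auto simp: S'_def)
  let ?b = "\<lambda>a M. four_block_mat (mat 1 1 (\<lambda>_. a)) (0\<^sub>m 1 n) (0\<^sub>m n 1) M :: real mat"
  have one: "1\<^sub>m 1 = mat 1 1 (\<lambda>_. 1)" by (intro eq_matI) auto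
  have bmult: "?b a M * ?b c M' = ?b (a * c) (M * M')"
    if "M \<in> carrier_mat n n" "M' \<in> carrier_mat n n" for a c M M'
    using that
    by (subst mult_four_block_mat[of _ 1 1 _ n _ n _ _ 1 _ n])
       (auto intro!: cong_four_block_mat eq_matI simp: scalar_prod_def)
  define P where "P = ?b 1 U"
  have P: "P \<in> carrier_mat ?N ?N" using U by (auto simp: P_def)
  have PT: "transpose_mat P = ?b 1 (transpose_mat U)"
    unfolding P_def using U
    by (subst transpose_four_block_mat[of _ 1 1 _ n _ n]) (auto intro!: cong_four_block_mat eq_matI)
  have id: "?b 1 (1\<^sub>m n) = 1\<^sub>m ?N" using four_block_one_mat[of 1 n] unfolding one by simp
  have PP: "P * transpose_mat P = 1\<^sub>m ?N" "transpose_mat P * P = 1\<^sub>m ?N"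
    unfolding PT unfolding P_def
    using bmult[of U "transpose_mat U" 1 1] bmult[of "transpose_mat U" U 1 1] U id by auto
  define d' where "d' = case_nat e d"
  have "?b e (mat_diag n d) = mat_diag ?N d'"
    by (intro eq_matI) (auto simp: mat_diag_def d'_def split: nat.splits)
  moreover have "B = ?b e S'"
    using B by (intro eq_matI) (auto simp: S'_def B0 B0' )
  moreover have "?b e S' = P * ?b e (mat_diag n d) * transpose_mat P"
    unfolding PT unfolding P_def S'
    using bmult[of U "mat_diag n d" 1 e] bmult[of "U * mat_diag n d" "transpose_mat U" e 1] U
    by (simp add: mult_carrier_mat[of _ n n _ n])
  ultimately have BP: "B = P * mat_diag ?N d' * transpose_mat P" by simp
  have "S = W * B * W"
  proof -
    have "W * B * W = (W * W) * S * (W * W)" unfolding B_def using W(1) S by (simp del: W(3))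
    then show ?thesis using W S by simp
  qed
  also have "\<dots> = (W * P) * mat_diag ?N d' * transpose_mat (W * P)"
    unfolding BP using W(1,2) P by (simp add: transpose_mult[of _ ?N ?N _ ?N] mat_diag_dim)
  finally have "S = (W * P) * mat_diag ?N d' * transpose_mat (W * P)" .
  moreover have "(W * P) * transpose_mat (W * P) = 1\<^sub>m ?N"
  proof -
    have "(W * P) * transpose_mat (W * P) = W * (P * transpose_mat P) * W"
      using W(1,2) P by (simp add: transpose_mult[of _ ?N ?N _ ?N])
    then show ?thesis using W PP by simp
  qed
  moreover have "transpose_mat (W * P) * (W * P) = 1\<^sub>m ?N"
  proof -
    have "transpose_mat (W * P) * (W * P) = transpose_mat P * ((W * W) * P)"
      using W(1,2) P by (simp add: transpose_mult[of _ ?N ?N _ ?N])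
    then show ?thesis using W P PP by simp
  qed
  ultimately show ?case using W P by (intro exI[of _ "W * P"] exI[of _ d']) auto
qed

section \<open>Scalar power inequalities\<close>

text \<open>The weighted inequality between the arithmetic and the geometric mean of \<open>u\<close> and 1.\<close>

lemma powr_le_tangent_at_1:
  fixes u :: real assumes "0 \<le> u" "0 < t" "t \<le> 1"
  shows "u powr t \<le> 1 + t * (u - 1)"
proof (cases "u = 0")
  case False
  then show ?thesis
    using Youngs_inequality_0[of t "1 - t" u 1] assms by (simp add: algebra_simps)
qed (use assms in simp)

text \<open>The concave estimate with exponent \<open>1 / s\<close>, taken at the point \<open>u\<^sup>s\<close>.\<close>

lemma powr_ge_tangent_at_1:
  fixes u :: real assumes "0 \<le> u" "1 \<le> s"
  shows "1 + s * (u - 1) \<le> u powr s"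
  using powr_le_tangent_at_1[of "u powr s" "1 / s"] assms by (simp add: powr_powr field_simps)

lemma powr_ge_tangent:
  fixes a z :: real assumes "0 \<le> z" "0 < a" "1 \<le> s"
  shows "a powr s + s * a powr (s - 1) * (z - a) \<le> z powr s"
proof -
  have "a powr s * (1 + s * (z / a - 1)) \<le> a powr s * (z / a) powr s"
    by (intro mult_left_mono powr_ge_tangent_at_1) (use assms in auto)
  also have "\<dots> = z powr s" using assms by (simp add: powr_divide)
  also have "a powr s * (1 + s * (z / a - 1)) = a powr s + s * a powr (s - 1) * (z - a)"
    using assms by (simp add: powr_diff field_simps)
  finally show ?thesis .
qed

text \<open>The power \<open>w\<^sup>r\<close> is a convex function of \<open>1 / w\<close>; this is its tangent at \<open>w = 1\<close>.\<close>

lemma powr_ge_reciprocal_tangent: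
  fixes w :: real assumes "0 < w" "0 < r"
  shows "1 + r \<le> w powr r + r / w"
proof -
  have "(w powr r) powr (1 / (1 + r)) * (1 / w) powr (r / (1 + r))
      \<le> 1 / (1 + r) * w powr r + r / (1 + r) * (1 / w)"
    by (rule Youngs_inequality_0) (use assms in \<open>auto simp: field_simps\<close>)
  also have "(w powr r) powr (1 / (1 + r)) * (1 / w) powr (r / (1 + r)) = 1"
    using assms by (simp add: powr_powr powr_divide)
  finally have "1 + r \<le> (1 + r) * (1 / (1 + r) * w powr r + r / (1 + r) * (1 / w))"
    using assms by (simp only: mult_le_cancel_left1) simp
  also have "\<dots> = w powr r + r / w" using assms by (simp add: distrib_left)
  finally show ?thesis .
qed

lemma powr_convex_combination:
  fixes u v :: real
  assumes "0 \<le> u" "0 \<le> v" "0 \<le> l" "l \<le> 1" "1 \<le> s"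
  shows "(l * u + (1 - l) * v) powr s \<le> l * u powr s + (1 - l) * v powr s"
proof -
  define t where "t = l * u + (1 - l) * v"
  have t0: "0 \<le> t" using assms by (simp add: t_def)
  show ?thesis
  proof (cases "t = 0")
    case True
    then show ?thesis using assms by (simp flip: t_def)
  next
    case False
    then have t: "0 < t" using t0 by simp
    have "t powr s = l * (t powr s + s * t powr (s - 1) * (u - t))
        + (1 - l) * (t powr s + s * t powr (s - 1) * (v - t))"
      by (simp add: t_def algebra_simps)
    also have "\<dots> \<le> l * u powr s + (1 - l) * v powr s"
      by (intro add_mono mult_left_mono powr_ge_tangent) (use assms t in auto)
    finally show ?thesis by (simp add: t_def)
  qed
qed

lemma powr_add_le_two_powr:
  fixes a b :: real assumes "0 \<le> a" "0 \<le> b" "1 \<le> s"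
  shows "(a + b) powr s \<le> 2 powr (s - 1) * (a powr s + b powr s)"
proof -
  have "(a + b) powr s = 2 powr s * (1 / 2 * a + (1 - 1 / 2) * b) powr s"
    using assms by (subst powr_mult[symmetric]) (auto simp: algebra_simps)
  also have "\<dots> \<le> 2 powr s * (1 / 2 * a powr s + (1 - 1 / 2) * b powr s)"
    by (intro mult_left_mono powr_convex_combination) (use assms in auto)
  also have "\<dots> = 2 powr (s - 1) * (a powr s + b powr s)"
    by (simp add: powr_diff algebra_simps)
  finally show ?thesis .
qed

text \<open>The convex estimate with exponent \<open>1 / r\<close>, applied to \<open>a\<^sup>r\<close> and \<open>b\<^sup>r\<close>.\<close>

lemma add_powr_le_two_powr:
  fixes a b :: real assumes "0 \<le> a" "0 \<le> b" "0 < r" "r \<le> 1"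
  shows "a powr r + b powr r \<le> 2 powr (1 - r) * (a + b) powr r"
proof -
  have "(a powr r + b powr r) powr (1 / r) \<le> 2 powr (1 / r - 1) * (a + b)"
    using powr_add_le_two_powr[of "a powr r" "b powr r" "1 / r"] assms by (simp add: powr_powr)
  then have "((a powr r + b powr r) powr (1 / r)) powr r \<le> (2 powr (1 / r - 1) * (a + b)) powr r"
    by (intro powr_mono2) (use assms in auto)
  then show ?thesis using assms by (simp add: powr_powr powr_mult left_diff_distrib)
qed

section \<open>Quadratic forms in an orthonormal eigenbasis\<close>

definition ortho_mat :: "nat \<Rightarrow> real mat \<Rightarrow> bool" where
  "ortho_mat n U \<longleftrightarrow> U \<in> carrier_mat n n \<and> U * transpose_mat U = 1\<^sub>m n \<and> transpose_mat U * U = 1\<^sub>m n"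

text \<open>The quadratic form of \<open>U diag(d) U\<^sup>T\<close>, see \<open>quadratic_form_diag\<close>. Powers of the matrix only
  change \<open>d\<close>, which is why the inequalities below are stated for this form rather than for matrices.\<close>

definition diag_form :: "nat \<Rightarrow> real mat \<Rightarrow> (nat \<Rightarrow> real) \<Rightarrow> real vec \<Rightarrow> real" where
  "diag_form n U d x = (\<Sum>i<n. d i * (col U i \<bullet> x)\<^sup>2)"

lemma ortho_mat_carrier: "ortho_mat n U \<Longrightarrow> U \<in> carrier_mat n n"
  by (simp add: ortho_mat_def)

lemma col_carrier_ortho: "ortho_mat n U \<Longrightarrow> i < n \<Longrightarrow> col U i \<in> carrier_vec n"
  by (auto simp: ortho_mat_def)

lemma col_scalar_prod_ortho:
  assumes "ortho_mat n U" "i < n" "j < n"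
  shows "col U i \<bullet> col U j = (if i = j then 1 else 0)"
proof -
  have "(transpose_mat U * U) $$ (i, j) = (1\<^sub>m n :: real mat) $$ (i, j)"
    using assms by (simp add: ortho_mat_def)
  then show ?thesis using assms ortho_mat_carrier[OF assms(1)] by simp
qed

lemma transpose_mult_vec_index:
  assumes "ortho_mat n U" "i < n"
  shows "(transpose_mat U *\<^sub>v x) $ i = col U i \<bullet> x"
  using assms ortho_mat_carrier[OF assms(1)] by simp

lemma scalar_prod_transpose_ortho:
  assumes U: "ortho_mat n U" and x: "x \<in> carrier_vec n" and y: "y \<in> carrier_vec n"
  shows "(transpose_mat U *\<^sub>v x) \<bullet> (transpose_mat U *\<^sub>v y) = x \<bullet> y"
proof -
  note c = ortho_mat_carrier[OF U]
  have "(transpose_mat U *\<^sub>v x) \<bullet> (transpose_mat U *\<^sub>v y) = x \<bullet> (U *\<^sub>v (transpose_mat U *\<^sub>v y))"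
    by (rule transpose_vec_mult_scalar[OF c _ x]) (use c y in auto)
  also have "U *\<^sub>v (transpose_mat U *\<^sub>v y) = (U * transpose_mat U) *\<^sub>v y"
    using c y by (simp add: assoc_mult_mat_vec[of _ n n _ n])
  finally show ?thesis using U y by (simp add: ortho_mat_def)
qed

lemma parseval:
  assumes U: "ortho_mat n U" and x: "x \<in> carrier_vec n"
  shows "(\<Sum>i<n. (col U i \<bullet> x)\<^sup>2) = x \<bullet> x"
proof -
  note c = ortho_mat_carrier[OF U]
  have "(\<Sum>i<n. (col U i \<bullet> x)\<^sup>2) = (transpose_mat U *\<^sub>v x) \<bullet> (transpose_mat U *\<^sub>v x)"
    using c by (simp add: scalar_prod_def[of "transpose_mat U *\<^sub>v x"] lessThan_atLeast0 power2_eq_square)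
  then show ?thesis using scalar_prod_transpose_ortho[OF U x x] by simp
qed

lemma mat_diag_mult_vec:
  assumes "y \<in> carrier_vec n"
  shows "mat_diag n d *\<^sub>v y = vec n (\<lambda>i. d i * y $ i)"
proof (rule eq_vecI)
  fix i assume "i < dim_vec (vec n (\<lambda>i. d i * y $ i))"
  then have i: "i < n" by simp
  have "(mat_diag n d *\<^sub>v y) $ i = (\<Sum>j<n. (if i = j then d j else 0) * y $ j)"
    using i assms by (auto simp: mat_diag_def scalar_prod_def lessThan_atLeast0 intro!: sum.cong)
  also have "\<dots> = (\<Sum>j<n. (if j = i then d i * y $ i else 0))"
    by (rule sum.cong) auto
  finally show "(mat_diag n d *\<^sub>v y) $ i = vec n (\<lambda>i. d i * y $ i) $ i" using i by simp
qed (simp add: mat_diag_def)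

lemma diag_mult_vec_coordinates:
  assumes U: "ortho_mat n U" and x: "x \<in> carrier_vec n"
  shows "transpose_mat U *\<^sub>v ((U * mat_diag n d * transpose_mat U) *\<^sub>v x)
    = vec n (\<lambda>i. d i * (col U i \<bullet> x))"
proof -
  note c = ortho_mat_carrier[OF U]
  have "(U * mat_diag n d * transpose_mat U) *\<^sub>v x = U *\<^sub>v (mat_diag n d *\<^sub>v (transpose_mat U *\<^sub>v x))"
    using c x by (simp add: assoc_mult_mat_vec[of _ n n _ n] mult_carrier_mat[of _ n n _ n])
  moreover have "transpose_mat U *\<^sub>v (U *\<^sub>v y) = y" if "y \<in> carrier_vec n" for y
    using c that U by (simp add: assoc_mult_mat_vec[of _ n n _ n, symmetric] ortho_mat_def)
  ultimately have "transpose_mat U *\<^sub>v ((U * mat_diag n d * transpose_mat U) *\<^sub>v x)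
      = mat_diag n d *\<^sub>v (transpose_mat U *\<^sub>v x)"
    using c x by (simp add: mult_mat_vec_carrier[of _ n n])
  also have "\<dots> = vec n (\<lambda>i. d i * (col U i \<bullet> x))"
    using c x by (subst mat_diag_mult_vec) (auto intro!: eq_vecI)
  finally show ?thesis .
qed

lemma quadratic_form_diag:
  assumes U: "ortho_mat n U" and x: "x \<in> carrier_vec n"
  shows "x \<bullet> ((U * mat_diag n d * transpose_mat U) *\<^sub>v x) = diag_form n U d x"
proof -
  note c = ortho_mat_carrier[OF U]
  let ?M = "U * mat_diag n d * transpose_mat U"
  have M: "?M \<in> carrier_mat n n" using c by (simp add: mult_carrier_mat[of _ n n _ n])
  have "x \<bullet> (?M *\<^sub>v x) = (transpose_mat U *\<^sub>v x) \<bullet> (transpose_mat U *\<^sub>v (?M *\<^sub>v x))"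
    by (rule scalar_prod_transpose_ortho[OF U x, symmetric]) (use M x in auto)
  also have "\<dots> = diag_form n U d x"
    unfolding diag_mult_vec_coordinates[OF U x] diag_form_def
      scalar_prod_def[of "transpose_mat U *\<^sub>v x"]
    using c by (auto simp: lessThan_atLeast0 power2_eq_square intro!: sum.cong)
  finally show ?thesis .
qed

lemma norm_diag_mult_vec:
  assumes U: "ortho_mat n U" and x: "x \<in> carrier_vec n"
  shows "((U * mat_diag n d * transpose_mat U) *\<^sub>v x) \<bullet> ((U * mat_diag n d * transpose_mat U) *\<^sub>v x)
    = diag_form n U (\<lambda>i. (d i)\<^sup>2) x"
proof -
  note c = ortho_mat_carrier[OF U]
  let ?M = "U * mat_diag n d * transpose_mat U"
  have M: "?M \<in> carrier_mat n n" using c by (simp add: mult_carrier_mat[of _ n n _ n])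
  have "(?M *\<^sub>v x) \<bullet> (?M *\<^sub>v x) = (transpose_mat U *\<^sub>v (?M *\<^sub>v x)) \<bullet> (transpose_mat U *\<^sub>v (?M *\<^sub>v x))"
    by (rule scalar_prod_transpose_ortho[OF U, symmetric]) (use M x in auto)
  also have "\<dots> = diag_form n U (\<lambda>i. (d i)\<^sup>2) x"
    unfolding diag_mult_vec_coordinates[OF U x] diag_form_def
      scalar_prod_def[of "vec n (\<lambda>i. d i * (col U i \<bullet> x))"]
    using c by (auto simp: lessThan_atLeast0 power2_eq_square intro!: sum.cong)
  finally show ?thesis .
qed

lemma diag_form_nonneg: "(\<And>i. i < n \<Longrightarrow> 0 \<le> d i) \<Longrightarrow> 0 \<le> diag_form n U d x"
  unfolding diag_form_def by (intro sum_nonneg mult_nonneg_nonneg) auto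

lemma diag_form_mono:
  "(\<And>i. i < n \<Longrightarrow> d i \<le> e i) \<Longrightarrow> diag_form n U d x \<le> diag_form n U e x"
  unfolding diag_form_def by (intro sum_mono mult_right_mono) auto

lemma diag_form_const:
  "ortho_mat n U \<Longrightarrow> x \<in> carrier_vec n \<Longrightarrow> diag_form n U (\<lambda>_. c) x = c * (x \<bullet> x)"
  unfolding diag_form_def by (simp add: sum_distrib_left[symmetric] parseval)

lemma diag_form_scale: "diag_form n U (\<lambda>i. c * d i) x = c * diag_form n U d x"
  unfolding diag_form_def by (simp add: sum_distrib_left mult.assoc)

lemma diag_form_add: "diag_form n U (\<lambda>i. d i + e i) x = diag_form n U d x + diag_form n U e x"
  unfolding diag_form_def by (simp add: sum.distrib distrib_right)

lemma diag_form_own_col: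
  assumes "ortho_mat n U" "k < n"
  shows "diag_form n U d (col U k) = d k"
proof -
  have "diag_form n U d (col U k) = (\<Sum>i<n. if i = k then d k else 0)"
    unfolding diag_form_def by (rule sum.cong) (use assms in \<open>auto simp: col_scalar_prod_ortho\<close>)
  then show ?thesis using assms by simp
qed

text \<open>Both sides are the trace of the product of the two diagonalized matrices.\<close>

lemma diag_form_col_swap:
  assumes U: "ortho_mat n U" and V: "ortho_mat n V"
  shows "(\<Sum>j<n. g j * diag_form n U d (col V j)) = (\<Sum>i<n. d i * diag_form n V g (col U i))"
proof -
  have "(\<Sum>j<n. g j * diag_form n U d (col V j)) = (\<Sum>j<n. \<Sum>i<n. g j * (d i * (col U i \<bullet> col V j)\<^sup>2))"
    unfolding diag_form_def by (simp add: sum_distrib_left)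
  also have "\<dots> = (\<Sum>i<n. \<Sum>j<n. g j * (d i * (col U i \<bullet> col V j)\<^sup>2))" by (rule sum.swap)
  also have "\<dots> = (\<Sum>i<n. d i * diag_form n V g (col U i))"
    unfolding diag_form_def sum_distrib_left
    by (intro sum.cong) (auto simp: comm_scalar_prod[OF col_carrier_ortho[OF U] col_carrier_ortho[OF V]])
  finally show ?thesis .
qed

lemma sum_diag_form_cols:
  assumes U: "ortho_mat n U" and V: "ortho_mat n V"
  shows "(\<Sum>j<n. diag_form n U d (col V j)) = (\<Sum>i<n. d i)"
  using diag_form_col_swap[OF U V, of "\<lambda>_. 1" d] U V
  by (simp add: diag_form_const col_carrier_ortho col_scalar_prod_ortho)

text \<open>The squared coordinates of a unit vector are weights of total 1. Convexity enters through
  the tangent at the mean, which turns into an inequality between the two forms.\<close>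

lemma diag_form_jensen:
  assumes U: "ortho_mat n U" and d: "\<And>i. i < n \<Longrightarrow> 0 \<le> d i"
    and x: "x \<in> carrier_vec n" "x \<bullet> x = 1" and s: "1 \<le> s"
  shows "diag_form n U d x powr s \<le> diag_form n U (\<lambda>i. d i powr s) x"
proof -
  define t where "t = diag_form n U d x"
  have t0: "0 \<le> t" unfolding t_def by (rule diag_form_nonneg[OF d])
  show ?thesis
  proof (cases "t = 0")
    case True
    then show ?thesis by (simp add: t_def diag_form_nonneg)
  next
    case False
    then have t: "0 < t" using t0 by simp
    have "t powr s = diag_form n U (\<lambda>i. (t powr s - s * t powr (s - 1) * t) + s * t powr (s - 1) * d i) x"
      unfolding diag_form_add diag_form_scale by (simp add: diag_form_const[OF U] x t_def)
    also have "\<dots> \<le> diag_form n U (\<lambda>i. d i powr s) x"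
    proof (rule diag_form_mono)
      fix i assume "i < n"
      then show "(t powr s - s * t powr (s - 1) * t) + s * t powr (s - 1) * d i \<le> d i powr s"
        using powr_ge_tangent[OF d t s, of i] by (simp add: algebra_simps)
    qed
    finally show ?thesis by (simp add: t_def)
  qed
qed

lemma diag_form_jensen_concave:
  assumes U: "ortho_mat n U" and d: "\<And>i. i < n \<Longrightarrow> 0 \<le> d i"
    and x: "x \<in> carrier_vec n" "x \<bullet> x = 1" and r: "0 < r" "r \<le> 1"
  shows "diag_form n U (\<lambda>i. d i powr r) x \<le> diag_form n U d x powr r"
proof -
  have "diag_form n U (\<lambda>i. d i powr r) x powr (1 / r) \<le> diag_form n U (\<lambda>i. (d i powr r) powr (1 / r)) x"
    by (rule diag_form_jensen) (use assms in auto)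
  also have "\<dots> = diag_form n U d x"
    using d r by (auto simp: diag_form_def powr_powr intro!: sum.cong)
  finally have "(diag_form n U (\<lambda>i. d i powr r) x powr (1 / r)) powr r \<le> diag_form n U d x powr r"
    by (intro powr_mono2) (use r in auto)
  then show ?thesis using r by (simp add: powr_powr diag_form_nonneg)
qed

text \<open>A weak form of operator monotonicity: if \<open>S \<le> Z\<close> and \<open>S u = a u\<close> for a unit vector \<open>u\<close>, then
  \<open>a\<^sup>r \<le> \<langle>u, Z\<^sup>r u\<rangle>\<close>, for every positive \<open>r\<close>. Testing \<open>a u u\<^sup>T \<le> S \<le> Z\<close> on \<open>y = Z\<inverse> u\<close>
  gives \<open>a \<langle>u, Z\<inverse> u\<rangle> \<le> 1\<close>, and \<open>w\<^sup>r\<close> is convex as a function of \<open>1 / w\<close>.\<close>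

lemma powr_eigenvalue_le_diag_form:
  assumes U: "ortho_mat n U" and X: "ortho_mat n X"
    and a: "\<And>i. i < n \<Longrightarrow> 0 \<le> a i" and z: "\<And>i. i < n \<Longrightarrow> 0 \<le> z i"
    and le: "\<And>x. x \<in> carrier_vec n \<Longrightarrow> diag_form n U a x \<le> diag_form n X z x"
    and i: "i < n" and r: "0 < r"
  shows "a i powr r \<le> diag_form n X (\<lambda>j. z j powr r) (col U i)"
proof (cases "a i = 0")
  case True
  then show ?thesis by (simp add: diag_form_nonneg)
next
  case False
  then have ai: "0 < a i" using a[OF i] by simp
  define u where "u = col U i"
  define c where "c j = col X j \<bullet> u" for j
  have u: "u \<in> carrier_vec n" "u \<bullet> u = 1"
    using col_carrier_ortho[OF U i] col_scalar_prod_ortho[OF U i i] by (auto simp: u_def)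
  have test: "a i * (u \<bullet> y)\<^sup>2 \<le> diag_form n X z y" if y: "y \<in> carrier_vec n" for y
  proof -
    have "a i * (u \<bullet> y)\<^sup>2 \<le> diag_form n U a y"
      unfolding diag_form_def u_def
      by (rule member_le_sum[of i _ "\<lambda>i. a i * (col U i \<bullet> y)\<^sup>2"]) (use i a in auto)
    then show ?thesis using le[OF y] by simp
  qed
  \<comment> \<open>\<open>Z\<close> may be singular, but \<open>u\<close> has no component in its kernel, so \<open>y\<close> below is still well chosen.\<close>
  have c0: "c j = 0" if j: "j < n" "z j = 0" for j
  proof -
    have "a i * (c j)\<^sup>2 \<le> 0"
      using test[OF col_carrier_ortho[OF X j(1)]] diag_form_own_col[OF X j(1)] j(2)
      by (simp add: c_def comm_scalar_prod[OF u(1) col_carrier_ortho[OF X j(1)]])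
    then show ?thesis using ai by (simp add: mult_le_0_iff)
  qed
  \<comment> \<open>This is \<open>Z\<inverse> u\<close> on the range of \<open>Z\<close>; division by zero contributes 0.\<close>
  define y where "y = X *\<^sub>v vec n (\<lambda>j. c j / z j)"
  note Xc = ortho_mat_carrier[OF X]
  have y: "y \<in> carrier_vec n" using Xc by (simp add: y_def mult_mat_vec_carrier[of _ n n])
  have "transpose_mat X *\<^sub>v y = vec n (\<lambda>j. c j / z j)"
    using X Xc unfolding y_def
    by (simp add: assoc_mult_mat_vec[of _ n n _ n, symmetric] ortho_mat_def)
  then have yj: "col X j \<bullet> y = c j / z j" if "j < n" for j
    using transpose_mult_vec_index[OF X that, of y] that by simp
  define t where "t = (\<Sum>j<n. (c j)\<^sup>2 / z j)"
  have "u \<bullet> y = (transpose_mat X *\<^sub>v u) \<bullet> (transpose_mat X *\<^sub>v y)"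
    by (rule scalar_prod_transpose_ortho[OF X u(1) y, symmetric])
  also have "\<dots> = t"
    using Xc by (auto simp: scalar_prod_def[of "transpose_mat X *\<^sub>v u"] lessThan_atLeast0 t_def
        c_def[symmetric] yj power2_eq_square intro!: sum.cong)
  finally have uy: "u \<bullet> y = t" .
  have Xy: "diag_form n X z y = t"
    unfolding diag_form_def t_def
    by (intro sum.cong) (auto simp: yj power2_eq_square)
  have t0: "0 \<le> t" unfolding t_def using z by (intro sum_nonneg) auto
  have at: "a i * t \<le> 1"
  proof (cases "t = 0")
    case False
    have "a i * t * t \<le> 1 * t" using test[OF y] by (simp add: uy Xy power2_eq_square)
    then show ?thesis using False t0 by (metis less_eq_real_def mult_right_le_imp_le)
  qed simp
  have "a i powr r \<le> a i powr r * ((1 + r) - r * (a i * t))"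
    using at r ai by (simp add: algebra_simps)
  also have "\<dots> = (\<Sum>j<n. a i powr r * ((1 + r) * (c j)\<^sup>2 - r * (a i * ((c j)\<^sup>2 / z j))))"
  proof -
    have "(\<Sum>j<n. a i powr r * ((1 + r) * (c j)\<^sup>2 - r * (a i * ((c j)\<^sup>2 / z j))))
        = a i powr r * ((1 + r) * (\<Sum>j<n. (c j)\<^sup>2) - r * (a i * t))"
      unfolding t_def by (simp only: sum_distrib_left sum_subtractf[symmetric])
    then show ?thesis using parseval[OF X u(1)] u(2) by (simp add: c_def)
  qed
  also have "\<dots> \<le> (\<Sum>j<n. z j powr r * (c j)\<^sup>2)"
  proof (rule sum_mono)
    fix j assume "j \<in> {..<n}"
    then have j: "j < n" by simp
    show "a i powr r * ((1 + r) * (c j)\<^sup>2 - r * (a i * ((c j)\<^sup>2 / z j))) \<le> z j powr r * (c j)\<^sup>2"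
    proof (cases "z j = 0")
      case True
      then show ?thesis using c0[OF j] by simp
    next
      case False
      then have zj: "0 < z j" using z[OF j] by simp
      have "a i powr r * (1 + r - r / (z j / a i)) \<le> a i powr r * (z j / a i) powr r"
        using powr_ge_reciprocal_tangent[of "z j / a i" r] zj ai r
        by (intro mult_left_mono) auto
      also have "\<dots> = z j powr r" using ai zj by (simp add: powr_divide)
      finally have "a i powr r * (1 + r - r / (z j / a i)) * (c j)\<^sup>2 \<le> z j powr r * (c j)\<^sup>2"
        by (rule mult_right_mono) simp
      then show ?thesis by (simp add: algebra_simps)
    qed
  qed
  finally show ?thesis by (simp add: diag_form_def c_def u_def)
qed

section \<open>Sums of powers under a gauge of the eigenvalues\<close>

text \<open>Eigen-decompositions of four positive semidefinite matrices: \<open>S\<close> (with \<open>U, a\<close>) and \<open>T\<close> (with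
  \<open>V, b\<close>), their sum \<open>Z = S + T\<close> (with \<open>X, z\<close>), and the sum of powers \<open>S\<^sup>r + T\<^sup>r\<close> (with \<open>W, h\<close>). The
  two sums are expressed by quadratic forms.\<close>

definition power_sum_eigen ::
  "nat \<Rightarrow> real \<Rightarrow> real mat \<Rightarrow> (nat \<Rightarrow> real) \<Rightarrow> real mat \<Rightarrow> (nat \<Rightarrow> real) \<Rightarrow> real mat \<Rightarrow> (nat \<Rightarrow> real)
    \<Rightarrow> real mat \<Rightarrow> (nat \<Rightarrow> real) \<Rightarrow> bool" where
  "power_sum_eigen n r U a V b X z W h \<longleftrightarrow>
     ortho_mat n U \<and> ortho_mat n V \<and> ortho_mat n X \<and> ortho_mat n W \<and>
     (\<forall>i<n. 0 \<le> a i \<and> 0 \<le> b i \<and> 0 \<le> z i \<and> 0 \<le> h i) \<and>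
     (\<forall>x\<in>carrier_vec n. diag_form n X z x = diag_form n U a x + diag_form n V b x) \<and>
     (\<forall>x\<in>carrier_vec n. diag_form n W h x =
        diag_form n U (\<lambda>i. a i powr r) x + diag_form n V (\<lambda>i. b i powr r) x)"

lemma power_sum_eigenD:
  assumes "power_sum_eigen n r U a V b X z W h"
  shows "ortho_mat n U" "ortho_mat n V" "ortho_mat n X" "ortho_mat n W"
    "i < n \<Longrightarrow> 0 \<le> a i" "i < n \<Longrightarrow> 0 \<le> b i" "i < n \<Longrightarrow> 0 \<le> z i" "i < n \<Longrightarrow> 0 \<le> h i"
    "x \<in> carrier_vec n \<Longrightarrow> diag_form n X z x = diag_form n U a x + diag_form n V b x"
    "x \<in> carrier_vec n \<Longrightarrow> diag_form n W h x =
        diag_form n U (\<lambda>i. a i powr r) x + diag_form n V (\<lambda>i. b i powr r) x"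
  using assms by (auto simp: power_sum_eigen_def)

lemma power_sum_eigen_commute:
  "power_sum_eigen n r U a V b X z W h \<Longrightarrow> power_sum_eigen n r V b U a X z W h"
  by (auto simp: power_sum_eigen_def)

text \<open>A norm on tuples of eigenvalues, together with the properties that depend on the norm in the
  main argument. Pinching says that the diagonal of a positive semidefinite matrix in any orthonormal basis is
  dominated by its spectrum, also after applying \<open>t \<mapsto> t\<^sup>s\<close>; the bound \<open>s \<ge> 1/2\<close> is what the Euclidean
  length allows, since \<open>t \<mapsto> t\<^bsup>2s\<^esup>\<close> has to be convex, and \<open>s = p / 2\<close> with \<open>p \<ge> 1\<close> meets it.\<close>

locale spectral_gauge =
  fixes n :: nat and g :: "(nat \<Rightarrow> real) \<Rightarrow> real"
  assumes mono: "(\<And>i. i < n \<Longrightarrow> 0 \<le> a i) \<Longrightarrow> (\<And>i. i < n \<Longrightarrow> a i \<le> b i) \<Longrightarrow> g a \<le> g b"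
    and scale: "0 \<le> c \<Longrightarrow> (\<And>i. i < n \<Longrightarrow> 0 \<le> a i) \<Longrightarrow> g (\<lambda>i. c * a i) = c * g a"
    and triangle: "(\<And>i. i < n \<Longrightarrow> 0 \<le> a i) \<Longrightarrow> (\<And>i. i < n \<Longrightarrow> 0 \<le> b i) \<Longrightarrow>
      g (\<lambda>i. a i + b i) \<le> g a + g b"
    and pinching: "ortho_mat n U \<Longrightarrow> ortho_mat n V \<Longrightarrow> (\<And>i. i < n \<Longrightarrow> 0 \<le> d i) \<Longrightarrow> 1 / 2 \<le> s \<Longrightarrow>
      g (\<lambda>j. diag_form n U d (col V j) powr s) \<le> g (\<lambda>i. d i powr s)"
    and power_sum_le: "1 \<le> r \<Longrightarrow> power_sum_eigen n r U a V b X z W h \<Longrightarrow> g h \<le> g (\<lambda>i. z i powr r)"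
    and power_sum_ge: "1 / 2 \<le> r \<Longrightarrow> r \<le> 1 \<Longrightarrow> power_sum_eigen n r U a V b X z W h \<Longrightarrow>
      g (\<lambda>i. z i powr r) \<le> g h"
begin

lemma nonneg:
  assumes "\<And>i. i < n \<Longrightarrow> 0 \<le> a i"
  shows "0 \<le> g a"
proof -
  have "g (\<lambda>_. 0) = 0" using scale[of 0 "\<lambda>_. 0"] by simp
  then show ?thesis using mono[of "\<lambda>_. 0" a] assms by simp
qed

lemma pinching_1:
  assumes "ortho_mat n U" "ortho_mat n V" "\<And>i. i < n \<Longrightarrow> 0 \<le> d i"
  shows "g (\<lambda>j. diag_form n U d (col V j)) \<le> g d"
proof -
  have "g (\<lambda>j. diag_form n U d (col V j)) \<le> g (\<lambda>j. diag_form n U d (col V j) powr 1)"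
    by (rule mono) (use assms in \<open>auto simp: diag_form_nonneg\<close>)
  also have "\<dots> \<le> g (\<lambda>i. d i powr 1)" by (rule pinching) (use assms in auto)
  also have "\<dots> \<le> g d" by (rule mono) (use assms in auto)
  finally show ?thesis .
qed

text \<open>At an eigenvector of \<open>Z\<close> the eigenvalue is the sum of the values of the forms of \<open>S\<close> and \<open>T\<close>;
  convexity is used first on these two numbers and then, as Jensen's inequality, in each form.\<close>

lemma sum_powr_le_power_sum:
  assumes r: "1 \<le> r" and H: "power_sum_eigen n r U a V b X z W h"
  shows "g (\<lambda>i. z i powr r) \<le> 2 powr (r - 1) * g h"
proof -
  note D = power_sum_eigenD[OF H]
  have "z k powr r \<le> 2 powr (r - 1) * diag_form n W h (col X k)" if k: "k < n" for k
  proof -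
    have x: "col X k \<in> carrier_vec n" "col X k \<bullet> col X k = 1"
      using col_carrier_ortho[OF D(3) k] col_scalar_prod_ortho[OF D(3) k k] by auto
    have "z k = diag_form n U a (col X k) + diag_form n V b (col X k)"
      using D(9)[OF x(1)] diag_form_own_col[OF D(3) k] by metis
    then have "z k powr r \<le> 2 powr (r - 1) *
        (diag_form n U a (col X k) powr r + diag_form n V b (col X k) powr r)"
      using powr_add_le_two_powr[OF _ _ r] D(5,6) by (simp add: diag_form_nonneg)
    also have "\<dots> \<le> 2 powr (r - 1) * diag_form n W h (col X k)"
      unfolding D(10)[OF x(1)]
      by (intro mult_left_mono add_mono diag_form_jensen) (use D x r in auto)
    finally show ?thesis .
  qed
  then have "g (\<lambda>i. z i powr r) \<le> g (\<lambda>k. 2 powr (r - 1) * diag_form n W h (col X k))"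
    by (intro mono) auto
  also have "\<dots> = 2 powr (r - 1) * g (\<lambda>k. diag_form n W h (col X k))"
    by (rule scale) (use D in \<open>auto simp: diag_form_nonneg\<close>)
  also have "\<dots> \<le> 2 powr (r - 1) * g h"
    by (intro mult_left_mono pinching_1) (use D in auto)
  finally show ?thesis .
qed

text \<open>The concave counterpart, read off at the eigenvectors of \<open>S\<^sup>r + T\<^sup>r\<close> instead of those of \<open>Z\<close>.\<close>

lemma power_sum_le_sum_powr:
  assumes r: "1 / 2 \<le> r" "r \<le> 1" and H: "power_sum_eigen n r U a V b X z W h"
  shows "g h \<le> 2 powr (1 - r) * g (\<lambda>i. z i powr r)"
proof -
  note D = power_sum_eigenD[OF H]
  have "h k \<le> 2 powr (1 - r) * diag_form n X z (col W k) powr r" if k: "k < n" for k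
  proof -
    have x: "col W k \<in> carrier_vec n" "col W k \<bullet> col W k = 1"
      using col_carrier_ortho[OF D(4) k] col_scalar_prod_ortho[OF D(4) k k] by auto
    have "h k = diag_form n U (\<lambda>i. a i powr r) (col W k) + diag_form n V (\<lambda>i. b i powr r) (col W k)"
      using D(10)[OF x(1)] diag_form_own_col[OF D(4) k] by metis
    also have "\<dots> \<le> diag_form n U a (col W k) powr r + diag_form n V b (col W k) powr r"
      by (intro add_mono diag_form_jensen_concave) (use D x r in auto)
    also have "\<dots> \<le> 2 powr (1 - r) * diag_form n X z (col W k) powr r"
      unfolding D(9)[OF x(1)]
      by (rule add_powr_le_two_powr) (use D r in \<open>auto simp: diag_form_nonneg\<close>)
    finally show ?thesis .
  qed
  then have "g h \<le> g (\<lambda>k. 2 powr (1 - r) * diag_form n X z (col W k) powr r)"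
    by (intro mono) (use D in auto)
  also have "\<dots> = 2 powr (1 - r) * g (\<lambda>k. diag_form n X z (col W k) powr r)"
    by (rule scale) auto
  also have "\<dots> \<le> 2 powr (1 - r) * g (\<lambda>i. z i powr r)"
    by (intro mult_left_mono pinching) (use D r in auto)
  finally show ?thesis .
qed

text \<open>Minkowski's inequality for the \<open>p\<close>-convexification of a monotone norm. The convex combination is
  taken with weights proportional to the two norms; adding \<open>e / 2\<close> to each keeps them positive.\<close>

lemma minkowski:
  assumes u: "\<And>i. i < n \<Longrightarrow> 0 \<le> u i" and v: "\<And>i. i < n \<Longrightarrow> 0 \<le> v i" and p: "1 \<le> p"
  shows "g (\<lambda>i. (u i + v i) powr p) powr (1 / p)
    \<le> g (\<lambda>i. u i powr p) powr (1 / p) + g (\<lambda>i. v i powr p) powr (1 / p)"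
proof (rule field_le_epsilon)
  fix e :: real assume e: "0 < e"
  define s where "s = g (\<lambda>i. u i powr p) powr (1 / p) + e / 2"
  define t where "t = g (\<lambda>i. v i powr p) powr (1 / p) + e / 2"
  define l where "l = s / (s + t)"
  have pos: "0 < s" "0 < t" using e by (auto simp: s_def t_def intro: add_nonneg_pos)
  have l: "0 \<le> l" "l \<le> 1" "1 - l = t / (s + t)" using pos by (auto simp: l_def field_simps)
  have bound: "g (\<lambda>i. w i powr p) \<le> q powr p" if "g (\<lambda>i. w i powr p) powr (1 / p) \<le> q" for w q
  proof -
    have "(g (\<lambda>i. w i powr p) powr (1 / p)) powr p \<le> q powr p"
      by (rule powr_mono2) (use that p in auto)
    then show ?thesis using p nonneg[of "\<lambda>i. w i powr p"] by (simp add: powr_powr)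
  qed
  have gs: "g (\<lambda>i. u i powr p) \<le> s powr p" by (rule bound) (use e in \<open>simp add: s_def\<close>)
  have gt: "g (\<lambda>i. v i powr p) \<le> t powr p" by (rule bound) (use e in \<open>simp add: t_def\<close>)
  let ?c = "(s + t) powr p * l / s powr p" and ?d = "(s + t) powr p * (1 - l) / t powr p"
  have point: "(u i + v i) powr p \<le> ?c * u i powr p + ?d * v i powr p" if i: "i < n" for i
  proof -
    have "(s + t) * l = s" "(s + t) * (1 - l) = t" using pos by (auto simp: l(3)) (simp add: l_def)
    then have "(s + t) * (l * (u i / s) + (1 - l) * (v i / t)) = u i + v i"
      using pos by (simp only: distrib_left mult.assoc[symmetric]) simp
    then have "(u i + v i) powr p = ((s + t) * (l * (u i / s) + (1 - l) * (v i / t))) powr p"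
      by simp
    also have "\<dots> = (s + t) powr p * (l * (u i / s) + (1 - l) * (v i / t)) powr p"
      using pos l u[OF i] v[OF i] by (subst powr_mult) auto
    also have "\<dots> \<le> (s + t) powr p * (l * (u i / s) powr p + (1 - l) * (v i / t) powr p)"
      by (intro mult_left_mono powr_convex_combination) (use pos l p u[OF i] v[OF i] in auto)
    also have "\<dots> = ?c * u i powr p + ?d * v i powr p"
      using pos u[OF i] v[OF i] by (simp add: powr_divide distrib_left)
    finally show ?thesis .
  qed
  have "g (\<lambda>i. (u i + v i) powr p) \<le> g (\<lambda>i. ?c * u i powr p + ?d * v i powr p)"
    by (rule mono) (use point in auto)
  also have "\<dots> \<le> g (\<lambda>i. ?c * u i powr p) + g (\<lambda>i. ?d * v i powr p)"
    by (rule triangle) (use l(1,2) pos in auto)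
  also have "\<dots> = ?c * g (\<lambda>i. u i powr p) + ?d * g (\<lambda>i. v i powr p)"
    using l(1,2) pos by (intro arg_cong2[of _ _ _ _ "(+)"] scale) auto
  also have "\<dots> \<le> ?c * s powr p + ?d * t powr p"
    by (intro add_mono mult_left_mono gs gt) (use l(1,2) pos in auto)
  also have "\<dots> = (s + t) powr p * l + (s + t) powr p * (1 - l)" using pos by simp
  also have "\<dots> = (s + t) powr p" by (simp add: right_diff_distrib)
  finally have "g (\<lambda>i. (u i + v i) powr p) powr (1 / p) \<le> ((s + t) powr p) powr (1 / p)"
    by (intro powr_mono2) (use p nonneg in auto)
  also have "\<dots> = s + t" using pos p by (simp add: powr_powr)
  finally show "g (\<lambda>i. (u i + v i) powr p) powr (1 / p)
      \<le> g (\<lambda>i. u i powr p) powr (1 / p) + g (\<lambda>i. v i powr p) powr (1 / p) + e"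
    by (simp add: s_def t_def)
qed

text \<open>This is the triangle inequality for \<open>\<parallel> |X|\<^sup>p \<parallel>\<^bsup>1/p\<^esup>\<close>, where \<open>X\<close> ranges over stacked pairs of
  matrices. The hypothesis on square roots is the triangle inequality for the vectors \<open>X x\<close>.\<close>

lemma modulus_triangle:
  assumes X: "ortho_mat n X" and Y: "ortho_mat n Y" and Y': "ortho_mat n Y'"
    and z: "\<And>i. i < n \<Longrightarrow> 0 \<le> z i" and y: "\<And>i. i < n \<Longrightarrow> 0 \<le> y i" and y': "\<And>i. i < n \<Longrightarrow> 0 \<le> y' i"
    and le: "\<And>x. x \<in> carrier_vec n \<Longrightarrow>
      sqrt (diag_form n X z x) \<le> sqrt (diag_form n Y y x) + sqrt (diag_form n Y' y' x)"
    and p: "1 \<le> p"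
  shows "g (\<lambda>i. z i powr (p / 2)) powr (1 / p)
    \<le> g (\<lambda>i. y i powr (p / 2)) powr (1 / p) + g (\<lambda>i. y' i powr (p / 2)) powr (1 / p)"
proof -
  have half: "sqrt t powr p = t powr (p / 2)" if "0 \<le> t" for t :: real
    using that by (simp add: powr_half_sqrt[symmetric] powr_powr)
  define u where "u k = sqrt (diag_form n Y y (col X k))" for k
  define v where "v k = sqrt (diag_form n Y' y' (col X k))" for k
  have uv: "0 \<le> u k" "0 \<le> v k" for k
    using y y' by (auto simp: u_def v_def diag_form_nonneg)
  have "z k powr (p / 2) \<le> (u k + v k) powr p" if k: "k < n" for k
  proof -
    have "sqrt (z k) \<le> u k + v k"
      using le[OF col_carrier_ortho[OF X k]] diag_form_own_col[OF X k] by (simp add: u_def v_def)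
    then have "sqrt (z k) powr p \<le> (u k + v k) powr p"
      using z[OF k] p by (intro powr_mono2) auto
    then show ?thesis using half[OF z[OF k]] by simp
  qed
  then have "g (\<lambda>i. z i powr (p / 2)) powr (1 / p) \<le> g (\<lambda>k. (u k + v k) powr p) powr (1 / p)"
    using p by (intro powr_mono2 mono nonneg) auto
  also have "\<dots> \<le> g (\<lambda>k. u k powr p) powr (1 / p) + g (\<lambda>k. v k powr p) powr (1 / p)"
    by (rule minkowski) (use uv p in auto)
  also have "\<dots> \<le> g (\<lambda>i. y i powr (p / 2)) powr (1 / p) + g (\<lambda>i. y' i powr (p / 2)) powr (1 / p)"
  proof (intro add_mono powr_mono2 nonneg)
    have "g (\<lambda>k. u k powr p) = g (\<lambda>k. diag_form n Y y (col X k) powr (p / 2))"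
      using y by (simp add: u_def half diag_form_nonneg)
    also have "\<dots> \<le> g (\<lambda>i. y i powr (p / 2))" by (rule pinching) (use X Y y p in auto)
    finally show "g (\<lambda>k. u k powr p) \<le> g (\<lambda>i. y i powr (p / 2))" .
    have "g (\<lambda>k. v k powr p) = g (\<lambda>k. diag_form n Y' y' (col X k) powr (p / 2))"
      using y' by (simp add: v_def half diag_form_nonneg)
    also have "\<dots> \<le> g (\<lambda>i. y' i powr (p / 2))" by (rule pinching) (use X Y' y' p in auto)
    finally show "g (\<lambda>k. v k powr p) \<le> g (\<lambda>i. y' i powr (p / 2))" .
  qed (use p in auto)
  finally show ?thesis .
qed

text \<open>For \<open>p \<ge> 2\<close> the factor \<open>2\<^bsup>1/2 - 1/p\<^esup>\<close> is lost on the two summands, for \<open>p \<le> 2\<close> the factor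
  \<open>2\<^bsup>1/p - 1/2\<^esup>\<close> is lost on the sum.\<close>

theorem power_sum_triangle:
  assumes H: "power_sum_eigen n (p / 2) U a V b X z W h"
    and H1: "power_sum_eigen n (p / 2) U1 a1 V1 b1 X1 z1 W1 h1"
    and H2: "power_sum_eigen n (p / 2) U2 a2 V2 b2 X2 z2 W2 h2"
    and le: "\<And>x. x \<in> carrier_vec n \<Longrightarrow>
      sqrt (diag_form n X z x) \<le> sqrt (diag_form n X1 z1 x) + sqrt (diag_form n X2 z2 x)"
    and p: "1 \<le> p"
  shows "2 powr (- \<bar>1 / p - 1 / 2\<bar>) * g h powr (1 / p) \<le> g h1 powr (1 / p) + g h2 powr (1 / p)"
proof -
  note D = power_sum_eigenD[OF H] and D1 = power_sum_eigenD[OF H1] and D2 = power_sum_eigenD[OF H2]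
  let ?Z = "g (\<lambda>i. z i powr (p / 2)) powr (1 / p)"
  let ?Z1 = "g (\<lambda>i. z1 i powr (p / 2)) powr (1 / p)"
  let ?Z2 = "g (\<lambda>i. z2 i powr (p / 2)) powr (1 / p)"
  have tri: "?Z \<le> ?Z1 + ?Z2"
    by (rule modulus_triangle[OF D(3) D1(3) D2(3)]) (use D D1 D2 le p in auto)
  have root: "s powr (1 / p) \<le> 2 powr (c / p) * t powr (1 / p)"
    if "s \<le> 2 powr c * t" "0 \<le> s" "0 \<le> t" for s t c :: real
  proof -
    have "s powr (1 / p) \<le> (2 powr c * t) powr (1 / p)"
      using that p by (intro powr_mono2) auto
    then show ?thesis using that by (simp add: powr_mult powr_powr)
  qed
  have gh: "0 \<le> g h" "0 \<le> g h1" "0 \<le> g h2" using D D1 D2 by (auto intro!: nonneg)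
  have gz: "0 \<le> g (\<lambda>i. w i powr (p / 2))" for w by (rule nonneg) simp
  show ?thesis
  proof (cases "2 \<le> p")
    case True
    let ?c = "1 / 2 - 1 / p"
    have c: "\<bar>1 / p - 1 / 2\<bar> = ?c" "(p / 2 - 1) / p = ?c" using True by (auto simp: field_simps)
    have "g h powr (1 / p) \<le> ?Z"
      using power_sum_le[OF _ H] True gh by (intro powr_mono2) auto
    also note tri
    also have "?Z1 + ?Z2 \<le> 2 powr ?c * g h1 powr (1 / p) + 2 powr ?c * g h2 powr (1 / p)"
      unfolding c(2)[symmetric]
      by (intro add_mono root sum_powr_le_power_sum[OF _ H1] sum_powr_le_power_sum[OF _ H2] gh gz)
        (use True in auto)
    finally have "2 powr (- ?c) * g h powr (1 / p)
        \<le> 2 powr (- ?c) * (2 powr ?c * (g h1 powr (1 / p) + g h2 powr (1 / p)))"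
      by (intro mult_left_mono) (auto simp: distrib_left)
    then show ?thesis unfolding c(1) by (simp add: mult.assoc[symmetric] powr_add[symmetric])
  next
    case False
    let ?c = "1 / p - 1 / 2"
    have c: "\<bar>1 / p - 1 / 2\<bar> = ?c" "(1 - p / 2) / p = ?c" using False p by (auto simp: field_simps)
    have "g h powr (1 / p) \<le> 2 powr ?c * ?Z"
      unfolding c(2)[symmetric]
      by (intro root power_sum_le_sum_powr[OF _ _ H] gh gz) (use False p in auto)
    also have "\<dots> \<le> 2 powr ?c * (?Z1 + ?Z2)" using tri by (intro mult_left_mono) auto
    also have "\<dots> \<le> 2 powr ?c * (g h1 powr (1 / p) + g h2 powr (1 / p))"
      using False p power_sum_ge[OF _ _ H1] power_sum_ge[OF _ _ H2] gz
      by (intro mult_left_mono add_mono powr_mono2) auto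
    finally have "2 powr (- ?c) * g h powr (1 / p)
        \<le> 2 powr (- ?c) * (2 powr ?c * (g h1 powr (1 / p) + g h2 powr (1 / p)))"
      by (intro mult_left_mono) auto
    then show ?thesis unfolding c(1) by (simp add: mult.assoc[symmetric] powr_add[symmetric])
  qed
qed

end

section \<open>The largest eigenvalue as a gauge\<close>

text \<open>The comparison of \<open>S\<^sup>r + T\<^sup>r\<close> with \<open>Z\<^sup>r\<close> needs only the fact that each eigenvalue of a summand
  is at most the largest eigenvalue of the sum. For \<open>r \<ge> 1\<close> this gives \<open>S\<^sup>r \<le> \<parallel>Z\<parallel>\<^bsup>r-1\<^esup> S\<close>; for \<open>r \<le> 1\<close>
  it gives \<open>S \<le> \<parallel>S\<^sup>r + T\<^sup>r\<parallel>\<^bsup>1/r - 1\<^esup> S\<^sup>r\<close>; likewise for \<open>T\<close>.\<close>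

lemma spectral_gauge_Max:
  assumes n: "n > 0"
  shows "spectral_gauge n (\<lambda>d. Max (d ` {..<n}))"
proof -
  let ?g = "\<lambda>d. Max (d ` {..<n}) :: real"
  have ge: "d i \<le> ?g d" if "i < n" for d i using that by (intro Max_ge) auto
  have le: "?g d \<le> c" if "\<And>i. i < n \<Longrightarrow> d i \<le> c" for d c using that n by (subst Max_le_iff) auto
  have attained: "\<exists>k<n. ?g d = d k" for d
  proof -
    have "?g d \<in> d ` {..<n}" by (rule Max_in) (use n in auto)
    then show ?thesis by auto
  qed
  have form_le: "diag_form n U d x \<le> ?g d" if "ortho_mat n U" "x \<in> carrier_vec n" "x \<bullet> x = 1" for U d x
    using diag_form_mono[of n d "\<lambda>_. ?g d" U x] diag_form_const[of n U x "?g d"] ge that by auto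
  have unit: "col X k \<in> carrier_vec n" "col X k \<bullet> col X k = 1" if "ortho_mat n X" "k < n" for X k
    using that col_carrier_ortho col_scalar_prod_ortho by auto
  have dominated: "diag_form n V f x \<le> c * diag_form n V e x"
    if "\<And>i. i < n \<Longrightarrow> f i \<le> c * e i" for V f e c x
    using diag_form_mono[of n f "\<lambda>i. c * e i"] that by (simp add: diag_form_scale)
  show ?thesis
  proof
    fix a b :: "nat \<Rightarrow> real" assume ab: "\<And>i. i < n \<Longrightarrow> a i \<le> b i"
    show "?g a \<le> ?g b" by (rule le) (rule order_trans[OF ab ge])
  next
    fix c :: real and a :: "nat \<Rightarrow> real"
    assume c: "0 \<le> c" and "\<And>i. i < n \<Longrightarrow> 0 \<le> a i"
    show "?g (\<lambda>i. c * a i) = c * ?g a"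
    proof (rule antisym)
      show "?g (\<lambda>i. c * a i) \<le> c * ?g a" by (rule le) (use ge c in \<open>auto intro: mult_left_mono\<close>)
      obtain k where "k < n" "?g a = a k" using attained[of a] by auto
      then show "c * ?g a \<le> ?g (\<lambda>i. c * a i)" using ge[of k "\<lambda>i. c * a i"] by simp
    qed
  next
    fix a b :: "nat \<Rightarrow> real"
    show "?g (\<lambda>i. a i + b i) \<le> ?g a + ?g b" by (rule le) (intro add_mono ge)
  next
    fix U V and d :: "nat \<Rightarrow> real" and s :: real
    assume U: "ortho_mat n U" and V: "ortho_mat n V" and d: "\<And>i. i < n \<Longrightarrow> 0 \<le> d i" and s: "1 / 2 \<le> s"
    obtain k where k: "k < n" "?g d = d k" using attained[of d] by auto
    show "?g (\<lambda>j. diag_form n U d (col V j) powr s) \<le> ?g (\<lambda>i. d i powr s)"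
    proof (rule le)
      fix j assume j: "j < n"
      have "diag_form n U d (col V j) powr s \<le> d k powr s"
        using form_le[OF U unit[OF V j], of d] k s d by (intro powr_mono2) (auto simp: diag_form_nonneg)
      also have "\<dots> \<le> ?g (\<lambda>i. d i powr s)" by (rule ge) (rule k)
      finally show "diag_form n U d (col V j) powr s \<le> ?g (\<lambda>i. d i powr s)" .
    qed
  next
    fix r :: real and U a V b X z W h
    assume r: "1 \<le> r" and H: "power_sum_eigen n r U a V b X z W h"
    note D = power_sum_eigenD[OF H]
    obtain k where k: "k < n" "?g z = z k" using attained[of z] by auto
    have small: "e i powr r \<le> z k powr (r - 1) * e i"
      if E: "ortho_mat n E" and e: "\<And>i. i < n \<Longrightarrow> 0 \<le> e i" and i: "i < n"
        and *: "\<And>x. x \<in> carrier_vec n \<Longrightarrow> diag_form n E e x \<le> diag_form n X z x" for E e i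
    proof (cases "e i = 0")
      case False
      have "e i \<le> z k"
        using *[OF unit(1)[OF E i]] form_le[OF D(3) unit[OF E i], of z] diag_form_own_col[OF E i, of e] k
        by simp
      then have "e i powr (r - 1) \<le> z k powr (r - 1)" using r e[OF i] by (intro powr_mono2) auto
      then have "e i powr (r - 1) * e i \<le> z k powr (r - 1) * e i" using e[OF i] by (rule mult_right_mono)
      then show ?thesis using e[OF i] False by (simp add: powr_diff)
    qed simp
    have small_a: "a i powr r \<le> z k powr (r - 1) * a i" if "i < n" for i
      by (rule small[OF D(1)]) (use D that in \<open>auto simp: diag_form_nonneg\<close>)
    have small_b: "b i powr r \<le> z k powr (r - 1) * b i" if "i < n" for i
      by (rule small[OF D(2)]) (use D that in \<open>auto simp: diag_form_nonneg\<close>)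
    show "?g h \<le> ?g (\<lambda>i. z i powr r)"
    proof (rule le)
      fix j assume j: "j < n"
      note x = unit[OF D(4) j]
      have "h j = diag_form n U (\<lambda>i. a i powr r) (col W j) + diag_form n V (\<lambda>i. b i powr r) (col W j)"
        using D(10)[OF x(1)] diag_form_own_col[OF D(4) j] by metis
      also have "\<dots> \<le> z k powr (r - 1) * diag_form n U a (col W j) + z k powr (r - 1) * diag_form n V b (col W j)"
        by (intro add_mono dominated small_a small_b)
      also have "\<dots> = z k powr (r - 1) * diag_form n X z (col W j)"
        using D(9)[OF x(1)] by (simp add: distrib_left)
      also have "\<dots> \<le> z k powr (r - 1) * z k"
        using form_le[OF D(3) x, of z] k by (intro mult_left_mono) auto
      also have "\<dots> = z k powr r" using D(7)[OF k(1)] by (cases "z k = 0") (auto simp: powr_diff)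
      also have "\<dots> \<le> ?g (\<lambda>i. z i powr r)" by (rule ge) (rule k)
      finally show "h j \<le> ?g (\<lambda>i. z i powr r)" .
    qed
  next
    fix r :: real and U a V b X z W h
    assume r: "1 / 2 \<le> r" "r \<le> 1" and H: "power_sum_eigen n r U a V b X z W h"
    note D = power_sum_eigenD[OF H]
    let ?h = "?g h"
    have h0: "0 \<le> ?h" using ge[OF n, of h] D(8)[OF n] by simp
    have small: "e i \<le> ?h powr (1 / r - 1) * e i powr r"
      if E: "ortho_mat n E" and e: "\<And>i. i < n \<Longrightarrow> 0 \<le> e i" and i: "i < n"
        and *: "\<And>x. x \<in> carrier_vec n \<Longrightarrow> diag_form n E (\<lambda>i. e i powr r) x \<le> diag_form n W h x" for E e i
    proof (cases "e i = 0")
      case False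
      have "e i powr r \<le> ?h"
        using *[OF unit(1)[OF E i]] form_le[OF D(4) unit[OF E i], of h]
          diag_form_own_col[OF E i, of "\<lambda>i. e i powr r"]
        by simp
      then have "(e i powr r) powr (1 / r - 1) \<le> ?h powr (1 / r - 1)"
        using r by (intro powr_mono2) auto
      then have "(e i powr r) powr (1 / r - 1) * e i powr r \<le> ?h powr (1 / r - 1) * e i powr r"
        by (rule mult_right_mono) simp
      then show ?thesis using e[OF i] False r by (simp add: powr_powr powr_add[symmetric] right_diff_distrib)
    qed simp
    have small_a: "a i \<le> ?h powr (1 / r - 1) * a i powr r" if "i < n" for i
      by (rule small[OF D(1)]) (use D that in \<open>auto simp: diag_form_nonneg\<close>)
    have small_b: "b i \<le> ?h powr (1 / r - 1) * b i powr r" if "i < n" for i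
      by (rule small[OF D(2)]) (use D that in \<open>auto simp: diag_form_nonneg\<close>)
    show "?g (\<lambda>i. z i powr r) \<le> ?g h"
    proof (rule le)
      fix j assume j: "j < n"
      note x = unit[OF D(3) j]
      have "z j = diag_form n U a (col X j) + diag_form n V b (col X j)"
        using D(9)[OF x(1)] diag_form_own_col[OF D(3) j] by metis
      also have "\<dots> \<le> ?h powr (1 / r - 1) * diag_form n U (\<lambda>i. a i powr r) (col X j)
          + ?h powr (1 / r - 1) * diag_form n V (\<lambda>i. b i powr r) (col X j)"
        by (intro add_mono dominated small_a small_b)
      also have "\<dots> = ?h powr (1 / r - 1) * diag_form n W h (col X j)"
        using D(10)[OF x(1)] by (simp add: distrib_left)
      also have "\<dots> \<le> ?h powr (1 / r - 1) * ?h"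
        using form_le[OF D(4) x, of h] by (intro mult_left_mono) auto
      also have "\<dots> = ?h powr (1 / r)" using h0 r by (cases "?h = 0") (auto simp: powr_diff)
      finally have "z j powr r \<le> (?h powr (1 / r)) powr r"
        using D(7)[OF j] r by (intro powr_mono2) auto
      then show "z j powr r \<le> ?h" using h0 r by (simp add: powr_powr)
    qed
  qed
qed

section \<open>The Euclidean length of the spectrum as a gauge\<close>

text \<open>Valid at \<open>z = 0\<close> because \<open>0 powr s = 0\<close> for every \<open>s\<close>, also for \<open>s = 0\<close>. This is what allows
  the exponent \<open>2 * r - 1\<close> to be 0 below.\<close>

lemma powr_mult_self: "0 \<le> z \<Longrightarrow> z powr (s - 1) * z = z powr s" for z :: real
  by (cases "z = 0") (auto simp: powr_diff)

lemma powr_squared: "(z powr r)\<^sup>2 = z powr (2 * r)" for z :: real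
  by (simp add: power2_eq_square powr_add[symmetric])

text \<open>With \<open>m = 2 r - 1 \<ge> 1\<close>, the right-hand side is \<open>tr S Z\<^sup>m + tr T Z\<^sup>m\<close>. Jensen's inequality at the
  eigenvectors of \<open>S\<close> and the tangent of \<open>t\<^sup>m\<close> give \<open>tr S Z\<^sup>m \<ge> tr S\<^bsup>2r\<^esup> + m tr S\<^sup>m T\<close>, and similarly
  for \<open>T\<close>. Since the left-hand side is \<open>tr S\<^bsup>2r\<^esup> + tr T\<^bsup>2r\<^esup> + 2 tr S\<^sup>r T\<^sup>r\<close>, it remains to see that
  \<open>2 tr S\<^sup>r T\<^sup>r \<le> tr S\<^sup>m T + tr S T\<^sup>m\<close>, which holds for each pair of eigenvalues.\<close>

lemma power_sum_frobenius_le: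
  assumes r: "1 \<le> r" and H: "power_sum_eigen n r U a V b X z W h"
  shows "(\<Sum>i<n. (h i)\<^sup>2) \<le> (\<Sum>i<n. (z i powr r)\<^sup>2)"
proof -
  note D = power_sum_eigenD[OF H]
  define m where "m = 2 * r - 1"
  have m: "1 \<le> m" using r by (simp add: m_def)
  let ?A = "\<lambda>i. a i powr r" and ?B = "\<lambda>i. b i powr r" and ?Z = "\<lambda>i. z i powr m"
  have unit: "col M k \<in> carrier_vec n" "col M k \<bullet> col M k = 1" if "ortho_mat n M" "k < n" for M k
    using that col_carrier_ortho col_scalar_prod_ortho by auto
  have lower: "(\<Sum>i<n. (e i powr r)\<^sup>2) + m * (\<Sum>i<n. e i powr m * diag_form n F f (col E i))
      \<le> (\<Sum>i<n. e i * diag_form n X ?Z (col E i))"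
    if E: "power_sum_eigen n r E e F f X z W h" for E e F f
  proof -
    note DE = power_sum_eigenD[OF E]
    have "(e i powr r)\<^sup>2 + m * (e i powr m * diag_form n F f (col E i)) \<le> e i * diag_form n X ?Z (col E i)"
      if i: "i < n" for i
    proof (cases "e i = 0")
      case False
      then have ei: "0 < e i" using DE(5)[OF i] by simp
      let ?q = "diag_form n X z (col E i)"
      have q: "?q = e i + diag_form n F f (col E i)"
        using DE(9)[OF unit(1)[OF DE(1) i]] diag_form_own_col[OF DE(1) i] by simp
      have "e i powr m + m * e i powr (m - 1) * (?q - e i) \<le> ?q powr m"
        by (rule powr_ge_tangent) (use DE m ei in \<open>auto simp: diag_form_nonneg\<close>)
      also have "\<dots> \<le> diag_form n X ?Z (col E i)"
        by (rule diag_form_jensen) (use DE unit[OF DE(1) i] m in auto)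
      finally have "e i * (e i powr m + m * e i powr (m - 1) * diag_form n F f (col E i))
          \<le> e i * diag_form n X ?Z (col E i)"
        using ei q by (intro mult_left_mono) auto
      moreover have "e i * e i powr m = (e i powr r)\<^sup>2" "e i * e i powr (m - 1) = e i powr m"
        using ei powr_mult_self[of "e i" "2 * r"] powr_mult_self[of "e i" m]
        by (auto simp: m_def powr_squared mult.commute)
      moreover have "e i * (e i powr m + m * e i powr (m - 1) * diag_form n F f (col E i))
          = e i * e i powr m + m * (e i * e i powr (m - 1) * diag_form n F f (col E i))"
        by (simp add: algebra_simps)
      ultimately show ?thesis by simp
    qed simp
    then have "(\<Sum>i<n. (e i powr r)\<^sup>2 + m * (e i powr m * diag_form n F f (col E i)))
        \<le> (\<Sum>i<n. e i * diag_form n X ?Z (col E i))" by (intro sum_mono) auto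
    then show ?thesis by (simp add: sum.distrib sum_distrib_left)
  qed
  have cross: "2 * (\<Sum>i<n. ?A i * diag_form n V ?B (col U i))
      \<le> (\<Sum>i<n. a i powr m * diag_form n V b (col U i)) + (\<Sum>i<n. b i powr m * diag_form n U a (col V i))"
  proof -
    have pt: "2 * (s powr r * t powr r) \<le> s powr m * t + s * t powr m" if st: "0 \<le> s" "0 \<le> t" for s t :: real
    proof (cases "s = 0 \<or> t = 0")
      case False
      then have pos: "0 < s" "0 < t" using st by auto
      have e: "x powr r = x powr (m / 2) * x powr (1 / 2)" for x :: real
        unfolding powr_add[symmetric] by (simp add: m_def diff_divide_distrib)
      have "s powr r * t powr r = (s powr (m / 2) * t powr (1 / 2)) * (s powr (1 / 2) * t powr (m / 2))"
        unfolding e by (simp only: ac_simps)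
      also have "2 * \<dots> \<le> (s powr (m / 2) * t powr (1 / 2))\<^sup>2 + (s powr (1 / 2) * t powr (m / 2))\<^sup>2"
        using sum_squares_bound[of "s powr (m / 2) * t powr (1 / 2)" "s powr (1 / 2) * t powr (m / 2)"]
        by (simp only: mult.assoc)
      also have "\<dots> = s powr m * t + s * t powr m"
        using pos by (simp add: power_mult_distrib powr_squared)
      finally show ?thesis by simp
    qed (use r in auto)
    have "2 * (?A i * diag_form n V ?B (col U i))
        \<le> a i powr m * diag_form n V b (col U i) + a i * diag_form n V (\<lambda>j. b j powr m) (col U i)"
      if i: "i < n" for i
    proof -
      have "diag_form n V (\<lambda>j. 2 * (?A i * ?B j)) (col U i)
          \<le> diag_form n V (\<lambda>j. a i powr m * b j + a i * b j powr m) (col U i)"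
        by (rule diag_form_mono) (use pt D i in auto)
      then show ?thesis by (simp add: diag_form_scale diag_form_add)
    qed
    then have "(\<Sum>i<n. 2 * (?A i * diag_form n V ?B (col U i)))
        \<le> (\<Sum>i<n. a i powr m * diag_form n V b (col U i) + a i * diag_form n V (\<lambda>j. b j powr m) (col U i))"
      by (intro sum_mono) auto
    then show ?thesis
      using diag_form_col_swap[OF D(1,2), of "\<lambda>j. b j powr m" a]
      by (simp add: sum_distrib_left sum.distrib)
  qed
  have "(\<Sum>i<n. (h i)\<^sup>2) = (\<Sum>k<n. h k * diag_form n W h (col W k))"
    by (intro sum.cong) (auto simp: diag_form_own_col[OF D(4)] power2_eq_square)
  also have "\<dots> = (\<Sum>k<n. h k * diag_form n U ?A (col W k)) + (\<Sum>k<n. h k * diag_form n V ?B (col W k))"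
    unfolding sum.distrib[symmetric]
    by (intro sum.cong) (auto simp: D(10)[OF unit(1)[OF D(4)]] distrib_left)
  also have "\<dots> = (\<Sum>i<n. ?A i * diag_form n W h (col U i)) + (\<Sum>i<n. ?B i * diag_form n W h (col V i))"
    using diag_form_col_swap[OF D(1) D(4), of h ?A] diag_form_col_swap[OF D(2) D(4), of h ?B] by simp
  also have "(\<Sum>i<n. ?A i * diag_form n W h (col U i))
      = (\<Sum>i<n. (?A i)\<^sup>2) + (\<Sum>i<n. ?A i * diag_form n V ?B (col U i))"
    unfolding sum.distrib[symmetric]
    by (intro sum.cong) (auto simp: D(10)[OF unit(1)[OF D(1)]] diag_form_own_col[OF D(1)]
        distrib_left power2_eq_square)
  also have "(\<Sum>i<n. ?B i * diag_form n W h (col V i))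
      = (\<Sum>i<n. (?B i)\<^sup>2) + (\<Sum>i<n. ?B i * diag_form n U ?A (col V i))"
    unfolding sum.distrib[symmetric]
    by (intro sum.cong) (auto simp: D(10)[OF unit(1)[OF D(2)]] diag_form_own_col[OF D(2)]
        distrib_left power2_eq_square)
  also have "(\<Sum>i<n. ?B i * diag_form n U ?A (col V i)) = (\<Sum>i<n. ?A i * diag_form n V ?B (col U i))"
    by (rule diag_form_col_swap[OF D(1,2)])
  finally have hh: "(\<Sum>i<n. (h i)\<^sup>2) = (\<Sum>i<n. (?A i)\<^sup>2) + (\<Sum>i<n. (?B i)\<^sup>2)
      + 2 * (\<Sum>i<n. ?A i * diag_form n V ?B (col U i))" by simp
  have zz: "(z k powr r)\<^sup>2 = ?Z k * diag_form n X z (col X k)" if "k < n" for k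
    using powr_mult_self[OF D(7)[OF that], of "2 * r"]
    by (simp add: diag_form_own_col[OF D(3) that] powr_squared m_def)
  have "(\<Sum>k<n. (z k powr r)\<^sup>2)
      = (\<Sum>k<n. ?Z k * diag_form n U a (col X k)) + (\<Sum>k<n. ?Z k * diag_form n V b (col X k))"
    unfolding sum.distrib[symmetric]
    by (intro sum.cong) (auto simp: zz D(9)[OF unit(1)[OF D(3)]] distrib_left)
  also have "\<dots> = (\<Sum>i<n. a i * diag_form n X ?Z (col U i)) + (\<Sum>i<n. b i * diag_form n X ?Z (col V i))"
    using diag_form_col_swap[OF D(1) D(3), of ?Z a] diag_form_col_swap[OF D(2) D(3), of ?Z b] by simp
  also have "\<dots> \<ge> (\<Sum>i<n. (?A i)\<^sup>2) + (\<Sum>i<n. (?B i)\<^sup>2)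
      + m * ((\<Sum>i<n. a i powr m * diag_form n V b (col U i)) + (\<Sum>i<n. b i powr m * diag_form n U a (col V i)))"
    using lower[OF H] lower[OF power_sum_eigen_commute[OF H]] by (simp add: distrib_left)
  finally have zz': "(\<Sum>i<n. (?A i)\<^sup>2) + (\<Sum>i<n. (?B i)\<^sup>2)
      + m * ((\<Sum>i<n. a i powr m * diag_form n V b (col U i)) + (\<Sum>i<n. b i powr m * diag_form n U a (col V i)))
      \<le> (\<Sum>k<n. (z k powr r)\<^sup>2)" .
  let ?C = "(\<Sum>i<n. a i powr m * diag_form n V b (col U i)) + (\<Sum>i<n. b i powr m * diag_form n U a (col V i))"
  have "0 \<le> ?C"
    using D by (intro add_nonneg_nonneg sum_nonneg mult_nonneg_nonneg diag_form_nonneg) auto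
  then have C: "?C \<le> m * ?C" using mult_right_mono[OF m, of ?C] by (simp only: mult_1_left)
  have "(\<Sum>i<n. (h i)\<^sup>2) \<le> (\<Sum>i<n. (?A i)\<^sup>2) + (\<Sum>i<n. (?B i)\<^sup>2) + ?C"
    unfolding hh by (rule add_left_mono[OF cross])
  also have "\<dots> \<le> (\<Sum>i<n. (?A i)\<^sup>2) + (\<Sum>i<n. (?B i)\<^sup>2) + m * ?C"
    by (rule add_left_mono[OF C])
  also note zz'
  finally show ?thesis .
qed

text \<open>With \<open>m = 2 r - 1\<close>, now between 0 and 1, the key is \<open>tr S Z\<^sup>m \<le> tr S\<^sup>r Z\<^sup>r\<close>. For a pair of
  eigenvalues this may fail, but it holds up to a multiple of \<open>tr S\<^sup>r Z\<^sup>r - tr S\<^bsup>2r\<^esup>\<close>, which is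
  nonnegative by the weak form of operator monotonicity. Adding the estimate for \<open>T\<close> yields
  \<open>tr Z\<^bsup>2r\<^esup> \<le> tr Z\<^sup>r (S\<^sup>r + T\<^sup>r)\<close>, and \<open>2 x y \<le> x\<^sup>2 + y\<^sup>2\<close> finishes the proof.\<close>

lemma power_sum_frobenius_ge:
  assumes r: "1 / 2 \<le> r" "r \<le> 1" and H: "power_sum_eigen n r U a V b X z W h"
  shows "(\<Sum>i<n. (z i powr r)\<^sup>2) \<le> (\<Sum>i<n. (h i)\<^sup>2)"
proof -
  note D = power_sum_eigenD[OF H]
  define m where "m = 2 * r - 1"
  let ?A = "\<lambda>i. a i powr r" and ?B = "\<lambda>i. b i powr r" and ?Z = "\<lambda>i. z i powr r"
  have unit: "col M k \<in> carrier_vec n" "col M k \<bullet> col M k = 1" if "ortho_mat n M" "k < n" for M k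
    using that col_carrier_ortho col_scalar_prod_ortho by auto
  \<comment> \<open>With \<open>v = (s / t)\<^sup>r\<close> the inequality \<open>pt\<close> is the tangent estimate for \<open>v\<^bsup>1/r - 1\<^esup>\<close> at \<open>v = 1\<close>;
    its slope there is this constant.\<close>
  define c where "c = (1 - r) / r"
  have c: "0 \<le> c" using r by (simp add: c_def)
  have pt: "s * t powr m \<le> s powr r * t powr r - c * (s powr r * t powr r - (s powr r)\<^sup>2)"
    if st: "0 < s" "0 \<le> t" for s t :: real
  proof (cases "t = 0")
    case True
    then show ?thesis using c by simp
  next
    case False
    then have t: "0 < t" using st by simp
    define v where "v = (s / t) powr r"
    have v: "0 < v" using st t by (simp add: v_def)
    have "v powr (1 / r - 1) \<le> 1 + (1 / r - 1) * (v - 1)"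
    proof (cases "r = 1")
      case False
      then show ?thesis using powr_le_tangent_at_1[of v "1 / r - 1"] v r by (simp add: field_simps)
    qed (use v in simp)
    then have "(t powr r)\<^sup>2 * v * v powr (1 / r - 1) \<le> (t powr r)\<^sup>2 * v * (1 + c * (v - 1))"
      using v r by (intro mult_left_mono) (auto simp: c_def diff_divide_distrib)
    moreover have "(t powr r)\<^sup>2 * v * v powr (1 / r - 1) = s * t powr m"
    proof -
      have "v * v powr (1 / r - 1) = s / t"
        using v st t r by (simp add: powr_diff) (simp add: v_def powr_powr)
      then have "(t powr r)\<^sup>2 * v * v powr (1 / r - 1) = t powr (2 * r) * (s / t)"
        by (simp add: mult.assoc powr_squared)
      then show ?thesis using t by (simp add: m_def powr_diff)
    qed
    moreover have tv: "t powr r * v = s powr r" using st t by (simp add: v_def powr_divide)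
    have "(t powr r)\<^sup>2 * v * (1 + c * (v - 1))
        = s powr r * t powr r - c * (s powr r * t powr r - (s powr r)\<^sup>2)"
      unfolding tv[symmetric] by (simp add: power2_eq_square algebra_simps)
    ultimately show ?thesis by simp
  qed
  have upper: "(\<Sum>k<n. z k powr m * diag_form n E e (col X k))
      \<le> (\<Sum>k<n. ?Z k * diag_form n E (\<lambda>i. e i powr r) (col X k))"
    if E: "power_sum_eigen n r E e F f X z W h" for E e F f
  proof -
    note DE = power_sum_eigenD[OF E]
    have le: "diag_form n E e x \<le> diag_form n X z x" if "x \<in> carrier_vec n" for x
      using DE(9)[OF that] diag_form_nonneg[of n f F x] DE(6) by simp
    have "e i * diag_form n X (\<lambda>k. z k powr m) (col E i) \<le> e i powr r * diag_form n X ?Z (col E i)"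
      if i: "i < n" for i
    proof (cases "e i = 0")
      case False
      then have ei: "0 < e i" using DE(5)[OF i] by simp
      let ?q = "diag_form n X ?Z (col E i)"
      have "e i * diag_form n X (\<lambda>k. z k powr m) (col E i)
          = diag_form n X (\<lambda>k. e i * z k powr m) (col E i)" by (simp add: diag_form_scale)
      also have "\<dots> \<le> diag_form n X (\<lambda>k. (1 - c) * e i powr r * z k powr r + c * (e i powr r)\<^sup>2) (col E i)"
        by (rule diag_form_mono) (use pt[OF ei DE(7)] in \<open>simp add: algebra_simps\<close>)
      also have "\<dots> = (1 - c) * e i powr r * ?q + c * (e i powr r)\<^sup>2"
        using unit[OF DE(1) i] by (simp add: diag_form_add diag_form_scale diag_form_const[OF DE(3)])
      also have "\<dots> = e i powr r * ?q - c * e i powr r * (?q - e i powr r)"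
        by (simp add: algebra_simps power2_eq_square)
      also have "\<dots> \<le> e i powr r * ?q"
      proof -
        have "e i powr r \<le> ?q"
          by (rule powr_eigenvalue_le_diag_form[OF DE(1) DE(3) DE(5) DE(7) le i]) (use r in auto)
        then show ?thesis using c by simp
      qed
      finally show ?thesis .
    qed simp
    then have "(\<Sum>i<n. e i * diag_form n X (\<lambda>k. z k powr m) (col E i))
        \<le> (\<Sum>i<n. e i powr r * diag_form n X ?Z (col E i))" by (intro sum_mono) auto
    then show ?thesis
      using diag_form_col_swap[OF DE(1) DE(3), of "\<lambda>k. z k powr m" e]
        diag_form_col_swap[OF DE(1) DE(3), of ?Z "\<lambda>i. e i powr r"] by simp
  qed
  have zz: "(z k powr r)\<^sup>2 = z k powr m * diag_form n X z (col X k)" if "k < n" for k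
    using powr_mult_self[OF D(7)[OF that], of "2 * r"]
    by (simp add: diag_form_own_col[OF D(3) that] powr_squared m_def)
  have "(\<Sum>k<n. (z k powr r)\<^sup>2)
      = (\<Sum>k<n. z k powr m * diag_form n U a (col X k)) + (\<Sum>k<n. z k powr m * diag_form n V b (col X k))"
    unfolding sum.distrib[symmetric]
    by (intro sum.cong) (auto simp: zz D(9)[OF unit(1)[OF D(3)]] distrib_left)
  also have "\<dots> \<le> (\<Sum>k<n. ?Z k * diag_form n U ?A (col X k)) + (\<Sum>k<n. ?Z k * diag_form n V ?B (col X k))"
    by (intro add_mono upper[OF H] upper[OF power_sum_eigen_commute[OF H]])
  also have "\<dots> = (\<Sum>k<n. ?Z k * diag_form n W h (col X k))"
    unfolding sum.distrib[symmetric]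
    by (intro sum.cong) (auto simp: D(10)[OF unit(1)[OF D(3)]] distrib_left)
  also have "\<dots> \<le> (\<Sum>k<n. ((?Z k)\<^sup>2 + (diag_form n W h (col X k))\<^sup>2) / 2)"
  proof (rule sum_mono)
    fix k
    show "?Z k * diag_form n W h (col X k) \<le> ((?Z k)\<^sup>2 + (diag_form n W h (col X k))\<^sup>2) / 2"
      using sum_squares_bound[of "?Z k" "diag_form n W h (col X k)"] by simp
  qed
  also have "\<dots> \<le> (\<Sum>k<n. ((?Z k)\<^sup>2 + diag_form n W (\<lambda>i. (h i)\<^sup>2) (col X k)) / 2)"
  proof (intro sum_mono divide_right_mono add_left_mono)
    fix k assume "k \<in> {..<n}"
    then have k: "k < n" by simp
    have "diag_form n W h (col X k) powr 2 \<le> diag_form n W (\<lambda>i. h i powr 2) (col X k)"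
      by (rule diag_form_jensen) (use D unit[OF D(3) k] in auto)
    moreover have "diag_form n W (\<lambda>i. h i powr 2) (col X k) = diag_form n W (\<lambda>i. (h i)\<^sup>2) (col X k)"
      unfolding diag_form_def using D(8) by (intro sum.cong) auto
    ultimately show "(diag_form n W h (col X k))\<^sup>2 \<le> diag_form n W (\<lambda>i. (h i)\<^sup>2) (col X k)"
      using D(8) by (simp add: diag_form_nonneg)
  qed simp
  also have "\<dots> = ((\<Sum>k<n. (?Z k)\<^sup>2) + (\<Sum>i<n. (h i)\<^sup>2)) / 2"
    using sum_diag_form_cols[OF D(4) D(3), of "\<lambda>i. (h i)\<^sup>2"]
    by (simp add: sum_divide_distrib[symmetric] sum.distrib)
  finally show ?thesis by simp
qed

lemma spectral_gauge_L2: "spectral_gauge n (\<lambda>d. L2_set d {..<n})"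
proof
  fix U V and d :: "nat \<Rightarrow> real" and s :: real
  assume U: "ortho_mat n U" and V: "ortho_mat n V" and d: "\<And>i. i < n \<Longrightarrow> 0 \<le> d i" and s: "1 / 2 \<le> s"
  have "(\<Sum>j<n. (diag_form n U d (col V j) powr s)\<^sup>2) \<le> (\<Sum>j<n. diag_form n U (\<lambda>i. d i powr (2 * s)) (col V j))"
    unfolding powr_squared
    by (intro sum_mono diag_form_jensen)
      (use U V d s in \<open>auto simp: col_carrier_ortho col_scalar_prod_ortho\<close>)
  also have "\<dots> = (\<Sum>i<n. (d i powr s)\<^sup>2)"
    unfolding powr_squared by (rule sum_diag_form_cols[OF U V])
  finally show "L2_set (\<lambda>j. diag_form n U d (col V j) powr s) {..<n} \<le> L2_set (\<lambda>i. d i powr s) {..<n}"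
    by (simp add: L2_set_def)
next
  fix a b :: "nat \<Rightarrow> real"
  assume "\<And>i. i < n \<Longrightarrow> 0 \<le> a i" "\<And>i. i < n \<Longrightarrow> a i \<le> b i"
  then show "L2_set a {..<n} \<le> L2_set b {..<n}" by (intro L2_set_mono) auto
next
  fix c :: real and a :: "nat \<Rightarrow> real" assume "0 \<le> c"
  then show "L2_set (\<lambda>i. c * a i) {..<n} = c * L2_set a {..<n}" by (simp add: L2_set_right_distrib)
next
  fix a b :: "nat \<Rightarrow> real"
  show "L2_set (\<lambda>i. a i + b i) {..<n} \<le> L2_set a {..<n} + L2_set b {..<n}"
    by (rule L2_set_triangle_ineq)
next
  fix r :: real and U a V b X z W h
  assume "1 \<le> r" "power_sum_eigen n r U a V b X z W h"
  then show "L2_set h {..<n} \<le> L2_set (\<lambda>i. z i powr r) {..<n}"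
    unfolding L2_set_def by (intro real_sqrt_le_mono power_sum_frobenius_le)
next
  fix r :: real and U a V b X z W h
  assume "1 / 2 \<le> r" "r \<le> 1" "power_sum_eigen n r U a V b X z W h"
  then show "L2_set (\<lambda>i. z i powr r) {..<n} \<le> L2_set h {..<n}"
    unfolding L2_set_def by (intro real_sqrt_le_mono power_sum_frobenius_ge)
qed

section \<open>Block circulant matrices and tensors\<close>

definition block_shift :: "nat \<Rightarrow> nat \<Rightarrow> nat \<Rightarrow> nat" where
  "block_shift m k i = (i + m) mod (m * k)"

text \<open>Invariance under a simultaneous cyclic shift of the block rows and block columns. In this form
  sums, products, transposes and functions of such matrices are seen to be of the same kind.\<close>

definition block_circulant :: "nat \<Rightarrow> nat \<Rightarrow> real mat \<Rightarrow> bool" where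
  "block_circulant m k M \<longleftrightarrow> M \<in> carrier_mat (m * k) (m * k) \<and>
     (\<forall>i<m * k. \<forall>j<m * k. M $$ (block_shift m k i, block_shift m k j) = M $$ (i, j))"

lemma block_circulant_carrier: "block_circulant m k M \<Longrightarrow> M \<in> carrier_mat (m * k) (m * k)"
  by (simp add: block_circulant_def)

lemma mult_mat_index_sum:
  "M \<in> carrier_mat p q \<Longrightarrow> M' \<in> carrier_mat q r \<Longrightarrow> i < p \<Longrightarrow> j < r \<Longrightarrow>
    (M * M') $$ (i, j) = (\<Sum>l<q. M $$ (i, l) * M' $$ (l, j))"
  by (auto simp: scalar_prod_def lessThan_atLeast0)

lemma diag_mat_index:
  assumes "U \<in> carrier_mat n n" "i < n" "j < n"
  shows "(U * mat_diag n d * transpose_mat U) $$ (i, j) = (\<Sum>l<n. U $$ (i, l) * d l * U $$ (j, l))"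
  using assms by (simp add: mat_diag_mult_right[of U n n] scalar_prod_def lessThan_atLeast0)

locale block_format =
  fixes m k :: nat
  assumes m: "m > 0" and k: "k > 0"
begin

lemma block_shift_div_mod:
  "block_shift m k i div m = (i div m + 1) mod k" "block_shift m k i mod m = i mod m"
  using m by (auto simp: block_shift_def mod_mult2_eq)

lemma block_shift_less: "block_shift m k i < m * k"
  using m k by (simp add: block_shift_def)

lemma block_div_less: "i < m * k \<Longrightarrow> i div m < k"
  by (simp add: less_mult_imp_div_less mult.commute)

lemma bij_betw_block_shift: "bij_betw (block_shift m k) {..<m * k} {..<m * k}"
proof -
  have "inj_on (block_shift m k) {..<m * k}"
  proof (rule inj_onI)
    fix i j assume ij: "i \<in> {..<m * k}" "j \<in> {..<m * k}" "block_shift m k i = block_shift m k j"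
    then have "i div m < k" "j div m < k" "(i div m + 1) mod k = (j div m + 1) mod k" "i mod m = j mod m"
      using block_shift_div_mod[of i] block_shift_div_mod[of j] block_div_less by auto
    moreover from this have "i div m = j div m"
      by (cases "i div m + 1 = k"; cases "j div m + 1 = k") auto
    ultimately show "i = j" by (metis div_mult_mod_eq)
  qed
  moreover have "block_shift m k ` {..<m * k} \<subseteq> {..<m * k}" using block_shift_less by auto
  ultimately show ?thesis by (simp add: bij_betw_def endo_inj_surj)
qed

lemma sum_block_shift: "(\<Sum>i<m * k. f (block_shift m k i)) = (\<Sum>i<m * k. f i :: real)"
  by (rule sum.reindex_bij_betw[OF bij_betw_block_shift])

text \<open>A shift by one block moves column \<open>j - m\<close> to column \<open>j\<close>, so the first block column determines the
  matrix. It identifies \<open>bcirc\<close> of sums, products and transposes, for which only that column has to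
  be computed.\<close>

lemma block_circulant_eqI:
  assumes M: "block_circulant m k M" and M': "block_circulant m k M'"
    and eq: "\<And>i j. i < m * k \<Longrightarrow> j < m \<Longrightarrow> M $$ (i, j) = M' $$ (i, j)"
  shows "M = M'"
proof -
  have "M $$ (i, j) = M' $$ (i, j)" if "i < m * k" "j < m * k" for i j
    using that
  proof (induction j arbitrary: i rule: less_induct)
    case (less j)
    show ?case
    proof (cases "j < m")
      case False
      obtain i' where i': "i' < m * k" "i = block_shift m k i'"
        using bij_betw_imp_surj_on[OF bij_betw_block_shift] less.prems(1) by (metis imageE lessThan_iff)
      have j: "j = block_shift m k (j - m)" using False less.prems by (simp add: block_shift_def)
      have "j - m < m * k" "j - m < j" using less.prems False m by auto
      then show ?thesis
        using less.IH[of "j - m" i'] M M' i' j by (metis block_circulant_def)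
    qed (use eq less in auto)
  qed
  then show ?thesis using M M' by (intro eq_matI) (auto simp: block_circulant_def)
qed

lemma block_circulant_add:
  "block_circulant m k M \<Longrightarrow> block_circulant m k M' \<Longrightarrow> block_circulant m k (M + M')"
  using block_shift_less by (auto simp: block_circulant_def)

lemma block_circulant_transpose: "block_circulant m k M \<Longrightarrow> block_circulant m k (transpose_mat M)"
  using block_shift_less by (auto simp: block_circulant_def)

lemma block_circulant_mult:
  assumes M: "block_circulant m k M" and M': "block_circulant m k M'"
  shows "block_circulant m k (M * M')"
proof -
  have c: "M \<in> carrier_mat (m * k) (m * k)" "M' \<in> carrier_mat (m * k) (m * k)"
    using M M' by (auto simp: block_circulant_def)
  let ?s = "block_shift m k"
  have "(M * M') $$ (?s i, ?s j) = (M * M') $$ (i, j)" if ij: "i < m * k" "j < m * k" for i j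
  proof -
    have "(M * M') $$ (?s i, ?s j) = (\<Sum>l<m * k. M $$ (?s i, ?s l) * M' $$ (?s l, ?s j))"
      using mult_mat_index_sum[OF c block_shift_less block_shift_less]
        sum_block_shift[of "\<lambda>l. M $$ (?s i, l) * M' $$ (l, ?s j)"] by simp
    also have "\<dots> = (\<Sum>l<m * k. M $$ (i, l) * M' $$ (l, j))"
      using M M' ij by (intro sum.cong) (auto simp: block_circulant_def)
    finally show ?thesis using mult_mat_index_sum[OF c ij] by simp
  qed
  then show ?thesis using c by (simp add: block_circulant_def mult_carrier_mat[OF c])
qed

lemma tensor_carrierD:
  assumes "A \<in> tensor_carrier m m k"
  shows "t_rows A = m" "t_cols A = m" "length A = k" "l < k \<Longrightarrow> A ! l \<in> carrier_mat m m"
proof -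
  have "hd A \<in> set A" using assms k by (cases A) (auto simp: tensor_carrier_def)
  then show "t_rows A = m" "t_cols A = m" "length A = k" "l < k \<Longrightarrow> A ! l \<in> carrier_mat m m"
    using assms by (auto simp: tensor_carrier_def)
qed

lemma bcirc_carrier: "A \<in> tensor_carrier m m k \<Longrightarrow> bcirc A \<in> carrier_mat (m * k) (m * k)"
  using tensor_carrierD by (auto simp: bcirc_def)

lemma bcirc_index:
  assumes "A \<in> tensor_carrier m m k" "i < m * k" "j < m * k"
  shows "bcirc A $$ (i, j) =
    (A ! nat ((int (i div m) - int (j div m)) mod int k)) $$ (i mod m, j mod m)"
  using assms(2,3) tensor_carrierD[OF assms(1)] by (simp add: bcirc_def)

lemma bcirc_index_first_column:
  assumes "A \<in> tensor_carrier m m k" "i < m * k" "j < m"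
  shows "bcirc A $$ (i, j) = (A ! (i div m)) $$ (i mod m, j)"
proof -
  have "j < m * k" using assms(3) k by (metis Suc_leI less_le_trans mult.right_neutral mult_le_mono2 One_nat_def)
  moreover have "int (i div m) mod int k = int (i div m)"
    using block_div_less[OF assms(2)] by simp
  ultimately show ?thesis using bcirc_index[OF assms(1,2), of j] assms(3) by simp
qed

lemma block_circulant_bcirc:
  assumes A: "A \<in> tensor_carrier m m k"
  shows "block_circulant m k (bcirc A)"
proof -
  have "bcirc A $$ (block_shift m k i, block_shift m k j) = bcirc A $$ (i, j)"
    if "i < m * k" "j < m * k" for i j
  proof -
    have "(int ((i div m + 1) mod k) - int ((j div m + 1) mod k)) mod int k
        = (int (i div m) - int (j div m)) mod int k"
      unfolding zmod_int mod_diff_eq by simp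
    then show ?thesis
      using that by (simp add: bcirc_index[OF A] block_shift_less block_shift_div_mod)
  qed
  then show ?thesis using bcirc_carrier[OF A] by (simp add: block_circulant_def)
qed

lemma block_index_less: "l < k \<Longrightarrow> i < m \<Longrightarrow> l * m + i < m * k"
proof -
  assume "l < k" "i < m"
  then have "l * m + i < Suc l * m" by simp
  also have "\<dots> \<le> k * m" using \<open>l < k\<close> by (intro mult_le_mono1) simp
  finally show ?thesis by (simp add: mult.commute)
qed

lemma bcirc_inject:
  assumes A: "A \<in> tensor_carrier m m k" and B: "B \<in> tensor_carrier m m k" and eq: "bcirc A = bcirc B"
  shows "A = B"
proof (rule nth_equalityI)
  note dA = tensor_carrierD[OF A] and dB = tensor_carrierD[OF B]
  show "length A = length B" by (simp add: dA dB)
  fix l assume "l < length A"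
  then have l: "l < k" by (simp add: dA)
  show "A ! l = B ! l"
  proof (rule eq_matI)
    fix i j assume "i < dim_row (B ! l)" "j < dim_col (B ! l)"
    then have ij: "i < m" "j < m" using dB(4)[OF l] by auto
    show "(A ! l) $$ (i, j) = (B ! l) $$ (i, j)"
      using bcirc_index_first_column[OF A block_index_less[OF l ij(1)] ij(2)]
        bcirc_index_first_column[OF B block_index_less[OF l ij(1)] ij(2)] eq ij by simp
  qed (use dA(4)[OF l] dB(4)[OF l] in auto)
qed

lemma t_fold_first_column:
  assumes X: "X \<in> carrier_mat (m * k) m"
  shows "t_fold k X \<in> tensor_carrier m m k"
    and "i < m * k \<Longrightarrow> j < m \<Longrightarrow> bcirc (t_fold k X) $$ (i, j) = X $$ (i, j)"
proof -
  show c: "t_fold k X \<in> tensor_carrier m m k"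
    using X k by (auto simp: t_fold_def tensor_carrier_def Let_def)
  assume ij: "i < m * k" "j < m"
  show "bcirc (t_fold k X) $$ (i, j) = X $$ (i, j)"
    using ij X k m block_div_less[OF ij(1)]
    by (simp add: bcirc_index_first_column[OF c ij]) (simp add: t_fold_def Let_def)
qed

lemma bcirc_surj:
  assumes M: "block_circulant m k M"
  shows "\<exists>B \<in> tensor_carrier m m k. bcirc B = M"
proof -
  define X where "X = mat (m * k) m (\<lambda>(i, j). M $$ (i, j))"
  have X: "X \<in> carrier_mat (m * k) m" by (simp add: X_def)
  have "bcirc (t_fold k X) = M"
    by (rule block_circulant_eqI[OF block_circulant_bcirc[OF t_fold_first_column(1)[OF X]] M])
      (simp add: t_fold_first_column(2)[OF X], simp add: X_def)
  then show ?thesis using t_fold_first_column(1)[OF X] by blast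
qed

lemma t_add_carrier_bcirc:
  assumes A: "A \<in> tensor_carrier m m k" and B: "B \<in> tensor_carrier m m k"
  shows "A +\<^sub>t B \<in> tensor_carrier m m k" "bcirc (A +\<^sub>t B) = bcirc A + bcirc B"
proof -
  note dA = tensor_carrierD[OF A] and dB = tensor_carrierD[OF B]
  have nth: "(A +\<^sub>t B) ! l = A ! l + B ! l" if "l < k" for l
    using that dA dB by (simp add: t_add_def)
  show c: "A +\<^sub>t B \<in> tensor_carrier m m k"
  proof -
    have "length (A +\<^sub>t B) = k" using dA dB by (simp add: t_add_def)
    moreover from this have "set (A +\<^sub>t B) \<subseteq> carrier_mat m m"
      using nth dA(4) dB(4) by (force simp: in_set_conv_nth)
    ultimately show ?thesis by (simp add: tensor_carrier_def)
  qed
  show "bcirc (A +\<^sub>t B) = bcirc A + bcirc B"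
  proof (rule block_circulant_eqI)
    fix i j assume ij: "i < m * k" "j < m"
    have l: "i div m < k" by (rule block_div_less[OF ij(1)])
    have j: "j < m * k" using block_index_less[OF k ij(2)] by simp
    show "bcirc (A +\<^sub>t B) $$ (i, j) = (bcirc A + bcirc B) $$ (i, j)"
      using ij j m bcirc_carrier[OF A] bcirc_carrier[OF B] dA(4)[OF l] dB(4)[OF l]
      by (simp add: bcirc_index_first_column[OF c ij] bcirc_index_first_column[OF A ij]
          bcirc_index_first_column[OF B ij] nth[OF l])
  qed (use A B c in \<open>auto intro: block_circulant_bcirc block_circulant_add\<close>)
qed

lemma t_prod_carrier_bcirc:
  assumes A: "A \<in> tensor_carrier m m k" and B: "B \<in> tensor_carrier m m k"
  shows "A *\<^sub>t B \<in> tensor_carrier m m k" "bcirc (A *\<^sub>t B) = bcirc A * bcirc B"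
proof -
  note dA = tensor_carrierD[OF A] and dB = tensor_carrierD[OF B]
  note cA = bcirc_carrier[OF A] and cB = bcirc_carrier[OF B]
  have u: "t_unfold B \<in> carrier_mat (m * k) m" using dB by (simp add: t_unfold_def)
  have X: "bcirc A * t_unfold B \<in> carrier_mat (m * k) m" using cA u by simp
  show c: "A *\<^sub>t B \<in> tensor_carrier m m k"
    using t_fold_first_column(1)[OF X] by (simp add: t_prod_def dA)
  show "bcirc (A *\<^sub>t B) = bcirc A * bcirc B"
  proof (rule block_circulant_eqI)
    fix i j assume ij: "i < m * k" "j < m"
    have j: "j < m * k" using block_index_less[OF k ij(2)] by simp
    have "bcirc (A *\<^sub>t B) $$ (i, j) = (bcirc A * t_unfold B) $$ (i, j)"
      using t_fold_first_column(2)[OF X ij] by (simp add: t_prod_def dA)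
    also have "\<dots> = (\<Sum>l<m * k. bcirc A $$ (i, l) * t_unfold B $$ (l, j))"
      by (rule mult_mat_index_sum[OF cA u ij])
    also have "\<dots> = (\<Sum>l<m * k. bcirc A $$ (i, l) * bcirc B $$ (l, j))"
      using ij by (intro sum.cong) (auto simp: bcirc_index_first_column[OF B] t_unfold_def dB)
    also have "\<dots> = (bcirc A * bcirc B) $$ (i, j)"
      by (rule mult_mat_index_sum[OF cA cB ij(1) j, symmetric])
    finally show "bcirc (A *\<^sub>t B) $$ (i, j) = (bcirc A * bcirc B) $$ (i, j)" .
  qed (use A B c in \<open>auto intro: block_circulant_bcirc block_circulant_mult\<close>)
qed

lemma t_transpose_carrier_bcirc:
  assumes A: "A \<in> tensor_carrier m m k"
  shows "t_transpose A \<in> tensor_carrier m m k" "bcirc (t_transpose A) = transpose_mat (bcirc A)"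
proof -
  note dA = tensor_carrierD[OF A]
  have len: "length (t_transpose A) = k" using dA k by (simp add: t_transpose_def)
  have nth: "t_transpose A ! l = transpose_mat (A ! nat ((- int l) mod int k))" if l: "l < k" for l
  proof (cases l)
    case 0
    then show ?thesis using dA k by (simp add: t_transpose_def nth_append)
  next
    case (Suc l')
    have "(- int l) mod int k = (int k - int l) mod int k" by simp
    also have "\<dots> = int k - int l" using Suc l by (intro mod_pos_pos_trivial) auto
    finally have "nat ((- int l) mod int k) = k - l" using l by simp
    moreover have "t_transpose A ! l = transpose_mat (A ! (k - l))"
      using Suc l dA k by (simp add: t_transpose_def nth_append rev_nth Suc_diff_Suc)
    ultimately show ?thesis by simp
  qed
  have in_range: "nat ((- int l) mod int k) < k" for l using k by (simp add: nat_less_iff)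
  show c: "t_transpose A \<in> tensor_carrier m m k"
  proof -
    have "t_transpose A ! l \<in> carrier_mat m m" if "l < k" for l
      unfolding nth[OF that] using dA(4)[OF in_range] by simp
    then have "set (t_transpose A) \<subseteq> carrier_mat m m" using len by (auto simp: in_set_conv_nth)
    then show ?thesis using len by (simp add: tensor_carrier_def)
  qed
  show "bcirc (t_transpose A) = transpose_mat (bcirc A)"
  proof (rule block_circulant_eqI)
    fix i j assume ij: "i < m * k" "j < m"
    have l: "i div m < k" by (rule block_div_less[OF ij(1)])
    have j: "j < m * k" using block_index_less[OF k ij(2)] by simp
    show "bcirc (t_transpose A) $$ (i, j) = transpose_mat (bcirc A) $$ (i, j)"
      using ij j m bcirc_carrier[OF A] dA(4)[OF in_range, of "i div m"]
      by (simp add: bcirc_index_first_column[OF c ij] nth[OF l] bcirc_index[OF A j ij(1)])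
  qed (use A c in \<open>auto intro: block_circulant_bcirc block_circulant_transpose\<close>)
qed

text \<open>Shifting the rows of \<open>U\<close> in a diagonalization of \<open>M\<close> gives another diagonalization of \<open>M\<close>. The
  power does not depend on the diagonalization, so it is invariant under the shift.\<close>

lemma block_circulant_psd_power:
  assumes M: "block_circulant m k M" and P: "is_psd_power M r P"
  shows "block_circulant m k P"
proof -
  let ?n = "m * k" and ?s = "block_shift m k"
  have Mc: "dim_row M = ?n" using block_circulant_carrier[OF M] by simp
  obtain U d where U: "U \<in> carrier_mat ?n ?n" "U * transpose_mat U = 1\<^sub>m ?n" "transpose_mat U * U = 1\<^sub>m ?n"
    and d: "\<forall>i<?n. 0 \<le> d i" and MU: "M = U * mat_diag ?n d * transpose_mat U"
    and PU: "P = U * mat_diag ?n (\<lambda>i. d i powr r) * transpose_mat U"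
    using P unfolding is_psd_power_def Mc Let_def by blast
  define V where "V = mat ?n ?n (\<lambda>(i, j). U $$ (?s i, j))"
  have V: "V \<in> carrier_mat ?n ?n" by (simp add: V_def)
  have conj: "(V * mat_diag ?n e * transpose_mat V) $$ (i, j)
      = (U * mat_diag ?n e * transpose_mat U) $$ (?s i, ?s j)" if "i < ?n" "j < ?n" for i j e
    unfolding diag_mat_index[OF V that] diag_mat_index[OF U(1) block_shift_less block_shift_less]
    using that by (simp add: V_def)
  have VTV: "transpose_mat V * V = 1\<^sub>m ?n"
  proof (rule eq_matI)
    fix i j assume "i < dim_row (1\<^sub>m ?n :: real mat)" "j < dim_col (1\<^sub>m ?n :: real mat)"
    then have ij: "i < ?n" "j < ?n" by auto
    have "(transpose_mat V * V) $$ (i, j) = (\<Sum>l<?n. U $$ (?s l, i) * U $$ (?s l, j))"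
      using ij V by (subst mult_mat_index_sum[of _ ?n ?n _ ?n]) (auto simp: V_def)
    also have "\<dots> = (\<Sum>l<?n. U $$ (l, i) * U $$ (l, j))"
      by (rule sum_block_shift[of "\<lambda>l. U $$ (l, i) * U $$ (l, j)"])
    also have "\<dots> = (transpose_mat U * U) $$ (i, j)"
      using ij U(1) by (subst mult_mat_index_sum[of _ ?n ?n _ ?n]) auto
    finally show "(transpose_mat V * V) $$ (i, j) = 1\<^sub>m ?n $$ (i, j)" by (simp add: U)
  qed (use V in auto)
  then have VVT: "V * transpose_mat V = 1\<^sub>m ?n"
    using mat_mult_left_right_inverse[of "transpose_mat V" ?n V] V by simp
  have "M = V * mat_diag ?n d * transpose_mat V"
  proof (rule eq_matI)
    fix i j assume "i < dim_row (V * mat_diag ?n d * transpose_mat V)"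
      "j < dim_col (V * mat_diag ?n d * transpose_mat V)"
    then have ij: "i < ?n" "j < ?n" using V by auto
    show "M $$ (i, j) = (V * mat_diag ?n d * transpose_mat V) $$ (i, j)"
      unfolding conj[OF ij] MU[symmetric] using M ij by (simp add: block_circulant_def)
  qed (use V block_circulant_carrier[OF M] in auto)
  then have "is_psd_power M r (V * mat_diag ?n (\<lambda>i. d i powr r) * transpose_mat V)"
    unfolding is_psd_power_def Mc Let_def using V VTV VVT d by blast
  then have "P = V * mat_diag ?n (\<lambda>i. d i powr r) * transpose_mat V"
    by (rule psd_power_unique[OF P])
  then have "P $$ (i, j) = P $$ (?s i, ?s j)" if "i < ?n" "j < ?n" for i j
    using conj[OF that, of "\<lambda>i. d i powr r"] PU by metis
  moreover have "P \<in> carrier_mat ?n ?n" using PU U(1) by (simp add: mult_carrier_mat[of _ ?n ?n _ ?n])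
  ultimately show ?thesis by (simp add: block_circulant_def)
qed

lemma t_powr_carrier_bcirc:
  assumes A: "A \<in> tensor_carrier m m k" and P: "is_psd_power (bcirc A) r P"
  shows "A powr\<^sub>t r \<in> tensor_carrier m m k" "bcirc (A powr\<^sub>t r) = P"
proof -
  have "mat_powr (bcirc A) r = P"
    unfolding mat_powr_def using P psd_power_unique by (intro the_equality) auto
  moreover obtain B where B: "B \<in> tensor_carrier m m k" "bcirc B = P"
    using bcirc_surj[OF block_circulant_psd_power[OF block_circulant_bcirc[OF A] P]] by blast
  ultimately have "A powr\<^sub>t r = B"
    unfolding t_powr_def tensor_carrierD[OF A] using bcirc_inject by (intro the_equality) auto
  then show "A powr\<^sub>t r \<in> tensor_carrier m m k" "bcirc (A powr\<^sub>t r) = P" using B by auto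
qed

end

section \<open>Diagonalized positive semidefinite matrices\<close>

lemma psd_diagonalization:
  assumes M: "M \<in> carrier_mat n n" "transpose_mat M = M"
    and psd: "\<And>x. x \<in> carrier_vec n \<Longrightarrow> 0 \<le> x \<bullet> (M *\<^sub>v x)"
  shows "\<exists>U d. ortho_mat n U \<and> (\<forall>i<n. 0 \<le> d i) \<and> M = U * mat_diag n d * transpose_mat U"
proof -
  obtain U d where U: "ortho_mat n U" and MU: "M = U * mat_diag n d * transpose_mat U"
    using real_spectral_theorem[OF M] by (auto simp: ortho_mat_def)
  have "0 \<le> d i" if i: "i < n" for i
    using psd[OF col_carrier_ortho[OF U i]] quadratic_form_diag[OF U col_carrier_ortho[OF U i], of d]
      diag_form_own_col[OF U i, of d] MU by simp
  then show ?thesis using U MU by blast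
qed

lemma diag_mat_carrier: "ortho_mat n U \<Longrightarrow> U * mat_diag n d * transpose_mat U \<in> carrier_mat n n"
  using ortho_mat_carrier[of n U] by (simp add: mult_carrier_mat[of _ n n _ n])

lemma transpose_diag_mat:
  assumes "ortho_mat n U"
  shows "transpose_mat (U * mat_diag n d * transpose_mat U) = U * mat_diag n d * transpose_mat U"
proof (rule eq_matI)
  note U = ortho_mat_carrier[OF assms]
  fix i j assume "i < dim_row (U * mat_diag n d * transpose_mat U)"
    "j < dim_col (U * mat_diag n d * transpose_mat U)"
  then have ij: "i < n" "j < n" using U by auto
  then have "transpose_mat (U * mat_diag n d * transpose_mat U) $$ (i, j)
      = (U * mat_diag n d * transpose_mat U) $$ (j, i)" using U by simp
  then show "transpose_mat (U * mat_diag n d * transpose_mat U) $$ (i, j)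
      = (U * mat_diag n d * transpose_mat U) $$ (i, j)"
    unfolding diag_mat_index[OF U ij] diag_mat_index[OF U ij(2,1)]
    by (simp add: ac_simps)
qed (use ortho_mat_carrier[OF assms] in auto)

lemma psd_power_of_diag_mat:
  assumes "ortho_mat n U" "\<forall>i<n. 0 \<le> d i"
  shows "is_psd_power (U * mat_diag n d * transpose_mat U) r
    (U * mat_diag n (\<lambda>i. d i powr r) * transpose_mat U)"
proof -
  have "dim_row (U * mat_diag n d * transpose_mat U) = n"
    using diag_mat_carrier[OF assms(1), of d] by blast
  then show ?thesis
    unfolding is_psd_power_def Let_def using assms by (auto simp: ortho_mat_def)
qed

lemma diag_mat_sum_diagonalization:
  assumes U: "ortho_mat n U" "\<forall>i<n. 0 \<le> a i" and V: "ortho_mat n V" "\<forall>i<n. 0 \<le> b i"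
  shows "\<exists>W h. ortho_mat n W \<and> (\<forall>i<n. 0 \<le> h i) \<and>
    U * mat_diag n a * transpose_mat U + V * mat_diag n b * transpose_mat V = W * mat_diag n h * transpose_mat W \<and>
    (\<forall>x\<in>carrier_vec n. diag_form n W h x = diag_form n U a x + diag_form n V b x)"
proof -
  let ?S = "U * mat_diag n a * transpose_mat U" and ?T = "V * mat_diag n b * transpose_mat V"
  note S = diag_mat_carrier[OF U(1), of a] and T = diag_mat_carrier[OF V(1), of b]
  have form: "x \<bullet> ((?S + ?T) *\<^sub>v x) = diag_form n U a x + diag_form n V b x" if x: "x \<in> carrier_vec n" for x
  proof -
    have "x \<bullet> ((?S + ?T) *\<^sub>v x) = x \<bullet> (?S *\<^sub>v x) + x \<bullet> (?T *\<^sub>v x)"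
      using S T x by (simp only: add_mult_distrib_mat_vec[OF S T x])
        (rule scalar_prod_add_distrib[of _ n], auto simp: mult_mat_vec_carrier[of _ n n])
    then show ?thesis by (simp only: quadratic_form_diag[OF U(1) x] quadratic_form_diag[OF V(1) x])
  qed
  have "transpose_mat (?S + ?T) = ?S + ?T"
    by (simp only: transpose_add[OF S T] transpose_diag_mat[OF U(1)] transpose_diag_mat[OF V(1)])
  moreover have "0 \<le> x \<bullet> ((?S + ?T) *\<^sub>v x)" if "x \<in> carrier_vec n" for x
    unfolding form[OF that] using U V by (simp add: diag_form_nonneg)
  moreover have "?S + ?T \<in> carrier_mat n n" using S T by simp
  ultimately obtain W h where W: "ortho_mat n W" "\<forall>i<n. 0 \<le> h i"
    and eq: "?S + ?T = W * mat_diag n h * transpose_mat W"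
    using psd_diagonalization by blast
  have "diag_form n W h x = diag_form n U a x + diag_form n V b x" if x: "x \<in> carrier_vec n" for x
    using form[OF x] unfolding eq quadratic_form_diag[OF W(1) x] .
  then show ?thesis using W eq by blast
qed

lemma gram_quadratic_form:
  fixes M :: "real mat"
  assumes M: "M \<in> carrier_mat n n" and x: "x \<in> carrier_vec n"
  shows "x \<bullet> ((transpose_mat M * M) *\<^sub>v x) = (M *\<^sub>v x) \<bullet> (M *\<^sub>v x)"
proof -
  have Mx: "M *\<^sub>v x \<in> carrier_vec n" using M x by simp
  have "x \<bullet> ((transpose_mat M * M) *\<^sub>v x) = (transpose_mat M *\<^sub>v (M *\<^sub>v x)) \<bullet> x"
    using M x Mx by (simp add: assoc_mult_mat_vec[of _ n n _ n])
      (rule comm_scalar_prod[of _ n], auto)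
  also have "\<dots> = (M *\<^sub>v x) \<bullet> (M *\<^sub>v x)" by (rule transpose_vec_mult_scalar[OF M x Mx])
  finally show ?thesis .
qed

lemma norm_vec_L2_set: "x \<in> carrier_vec n \<Longrightarrow> sqrt (x \<bullet> x) = L2_set (\<lambda>i. x $ i) {..<n}" for x :: "real vec"
  by (auto simp: scalar_prod_def L2_set_def lessThan_atLeast0 power2_eq_square)

lemma norm_vec_triangle:
  fixes x y :: "real vec"
  assumes x: "x \<in> carrier_vec n" and y: "y \<in> carrier_vec n"
  shows "sqrt ((x + y) \<bullet> (x + y)) \<le> sqrt (x \<bullet> x) + sqrt (y \<bullet> y)"
proof -
  have "L2_set (\<lambda>i. (x + y) $ i) {..<n} = L2_set (\<lambda>i. x $ i + y $ i) {..<n}"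
    using x y by (intro L2_set_cong) auto
  then show ?thesis
    unfolding norm_vec_L2_set[OF x] norm_vec_L2_set[OF y] norm_vec_L2_set[OF add_carrier_vec[OF x y]]
    using L2_set_triangle_ineq[of "\<lambda>i. x $ i" "\<lambda>i. y $ i" "{..<n}"] by simp
qed

text \<open>The triangle inequality for the vectors \<open>(M x, N x)\<close> and \<open>(M' x, N' x)\<close>.\<close>

lemma stacked_norm_triangle:
  fixes M M' N N' :: "real mat"
  assumes c: "M \<in> carrier_mat n n" "M' \<in> carrier_mat n n" "N \<in> carrier_mat n n" "N' \<in> carrier_mat n n"
    and x: "x \<in> carrier_vec n"
  shows "sqrt (((M + M') *\<^sub>v x) \<bullet> ((M + M') *\<^sub>v x) + ((N + N') *\<^sub>v x) \<bullet> ((N + N') *\<^sub>v x))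
    \<le> sqrt ((M *\<^sub>v x) \<bullet> (M *\<^sub>v x) + (N *\<^sub>v x) \<bullet> (N *\<^sub>v x))
      + sqrt ((M' *\<^sub>v x) \<bullet> (M' *\<^sub>v x) + (N' *\<^sub>v x) \<bullet> (N' *\<^sub>v x))"
proof -
  define s where "s K = sqrt ((K *\<^sub>v x) \<bullet> (K *\<^sub>v x))" for K :: "real mat"
  have sq: "(K *\<^sub>v x) \<bullet> (K *\<^sub>v x) = (s K)\<^sup>2" for K
    by (simp add: s_def scalar_prod_def sum_nonneg)
  have s0: "0 \<le> s K" for K by (simp add: s_def scalar_prod_def sum_nonneg)
  have tri: "s (K + K') \<le> s K + s K'" if "K \<in> carrier_mat n n" "K' \<in> carrier_mat n n" for K K'
    unfolding s_def add_mult_distrib_mat_vec[OF that x]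
    by (rule norm_vec_triangle[of _ n]) (use that x in auto)
  have "sqrt ((s (M + M'))\<^sup>2 + (s (N + N'))\<^sup>2) \<le> sqrt ((s M + s M')\<^sup>2 + (s N + s N')\<^sup>2)"
    by (intro real_sqrt_le_mono add_mono power_mono tri c s0)
  also have "\<dots> \<le> sqrt ((s M)\<^sup>2 + (s N)\<^sup>2) + sqrt ((s M')\<^sup>2 + (s N')\<^sup>2)"
    by (rule real_sqrt_sum_squares_triangle_ineq)
  finally show ?thesis unfolding sq .
qed

section \<open>Tensor norms through eigenvalues\<close>

lemma mat_spectral_norm_diag:
  assumes n: "n > 0" and U: "ortho_mat n U" and d: "\<And>i. i < n \<Longrightarrow> 0 \<le> d i"
  shows "mat_spectral_norm (U * mat_diag n d * transpose_mat U) = Max (d ` {..<n})"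
proof -
  let ?H = "U * mat_diag n d * transpose_mat U" and ?m = "Max (d ` {..<n})"
  have dim: "dim_col ?H = n" using diag_mat_carrier[OF U, of d] by blast
  have ge: "d i \<le> ?m" if "i < n" for i using that by (intro Max_ge) auto
  have "?m \<in> d ` {..<n}" by (rule Max_in) (use n in auto)
  then obtain j where j: "j < n" "?m = d j" by auto
  have m0: "0 \<le> ?m" using j d by simp
  show ?thesis
    unfolding mat_spectral_norm_def dim
  proof (rule cSup_eq_maximum)
    have "?m = sqrt ((?H *\<^sub>v col U j) \<bullet> (?H *\<^sub>v col U j))"
      unfolding norm_diag_mult_vec[OF U col_carrier_ortho[OF U j(1)]] diag_form_own_col[OF U j(1)]
      using j d by simp
    then show "?m \<in> {sqrt ((?H *\<^sub>v x) \<bullet> (?H *\<^sub>v x)) | x. x \<in> carrier_vec n \<and> x \<bullet> x = 1}"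
      using col_carrier_ortho[OF U j(1)] col_scalar_prod_ortho[OF U j(1) j(1)] by auto
  next
    fix t assume "t \<in> {sqrt ((?H *\<^sub>v x) \<bullet> (?H *\<^sub>v x)) | x. x \<in> carrier_vec n \<and> x \<bullet> x = 1}"
    then obtain x where x: "x \<in> carrier_vec n" "x \<bullet> x = 1" "t = sqrt ((?H *\<^sub>v x) \<bullet> (?H *\<^sub>v x))"
      by blast
    have "diag_form n U (\<lambda>i. (d i)\<^sup>2) x \<le> diag_form n U (\<lambda>i. ?m\<^sup>2) x"
      by (rule diag_form_mono) (use ge d in \<open>auto intro: power_mono\<close>)
    then have "diag_form n U (\<lambda>i. (d i)\<^sup>2) x \<le> ?m\<^sup>2" using x by (simp add: diag_form_const[OF U])
    from real_sqrt_le_mono[OF this] show "t \<le> ?m"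
      unfolding x(3) norm_diag_mult_vec[OF U x(1)] using m0 by simp
  qed
qed

text \<open>The columns of the matrix are its values at the standard basis, and the sum of their squared
  lengths is a trace, which does not depend on the basis.\<close>

lemma sum_squares_diag_mat:
  assumes U: "ortho_mat n U"
  shows "(\<Sum>j<n. \<Sum>i<n. ((U * mat_diag n d * transpose_mat U) $$ (i, j))\<^sup>2) = (\<Sum>i<n. (d i)\<^sup>2)"
proof -
  let ?H = "U * mat_diag n d * transpose_mat U"
  have H: "?H \<in> carrier_mat n n" by (rule diag_mat_carrier[OF U])
  have one: "ortho_mat n (1\<^sub>m n)" by (simp add: ortho_mat_def)
  have "(\<Sum>i<n. (?H $$ (i, j))\<^sup>2) = diag_form n U (\<lambda>i. (d i)\<^sup>2) (col (1\<^sub>m n) j)" if j: "j < n" for j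
  proof -
    have "?H *\<^sub>v unit_vec n j = col ?H j"
      using col_mult2[OF H one_carrier_mat j] H j by (simp add: right_mult_one_mat[OF H])
    then show ?thesis
      using norm_diag_mult_vec[OF U, of "unit_vec n j" d] H j carrier_matD[OF ortho_mat_carrier[OF U]]
      by (simp add: scalar_prod_def[of "col ?H j"] lessThan_atLeast0 power2_eq_square)
  qed
  then have "(\<Sum>j<n. \<Sum>i<n. (?H $$ (i, j))\<^sup>2) = (\<Sum>j<n. diag_form n U (\<lambda>i. (d i)\<^sup>2) (col (1\<^sub>m n) j))"
    by (intro sum.cong) auto
  then show ?thesis using sum_diag_form_cols[OF U one, of "\<lambda>i. (d i)\<^sup>2"] by simp
qed

lemma sum_lessThan_blocks:
  fixes m k :: nat
  shows "(\<Sum>i<m * k. f i) = (\<Sum>l<k. \<Sum>i<m. f (l * m + i) :: real)"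
proof (induction k)
  case (Suc k)
  have "(\<Sum>i<m * k + q. f i) = (\<Sum>i<m * k. f i) + (\<Sum>i<q. f (m * k + i))" for q
    by (induction q) (simp_all add: add.assoc)
  from this[of m] show ?case using Suc.IH by (simp add: add.commute mult.commute)
qed simp

context block_format
begin

text \<open>Each slice occurs \<open>k\<close> times in the block circulant matrix.\<close>

lemma frob_norm_bcirc:
  assumes A: "A \<in> tensor_carrier m m k"
  shows "(\<Sum>j<m * k. \<Sum>i<m * k. (bcirc A $$ (i, j))\<^sup>2) = k * (frob_norm A)\<^sup>2"
proof -
  let ?M = "bcirc A"
  note d = tensor_carrierD[OF A]
  define c where "c j = (\<Sum>i<m * k. (?M $$ (i, j))\<^sup>2)" for j
  have shift: "c (block_shift m k j) = c j" if "j < m * k" for j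
  proof -
    have "c (block_shift m k j) = (\<Sum>i<m * k. (?M $$ (block_shift m k i, block_shift m k j))\<^sup>2)"
      unfolding c_def by (rule sum_block_shift[symmetric])
    also have "\<dots> = c j"
      unfolding c_def using block_circulant_bcirc[OF A] that
      by (intro sum.cong) (auto simp: block_circulant_def)
    finally show ?thesis .
  qed
  have cmod: "c (l * m + j) = c j" if "l < k" "j < m" for l j
    using that
  proof (induction l)
    case (Suc l)
    have "block_shift m k (l * m + j) = Suc l * m + j"
      using block_index_less[OF Suc.prems] by (simp add: block_shift_def ac_simps)
    then show ?case
      using shift[OF block_index_less[of l j]] Suc by simp
  qed simp
  have "(\<Sum>j<m * k. c j) = k * (\<Sum>j<m. c j)"
    unfolding sum_lessThan_blocks by (simp add: cmod)
  also have "(\<Sum>j<m. c j) = (\<Sum>j<m. \<Sum>l<k. \<Sum>i<m. ((A ! l) $$ (i, j))\<^sup>2)"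
    unfolding c_def sum_lessThan_blocks
    using m by (intro sum.cong) (auto simp: bcirc_index_first_column[OF A] block_index_less)
  also have "\<dots> = (\<Sum>l<k. \<Sum>j<m. \<Sum>i<m. ((A ! l) $$ (i, j))\<^sup>2)" by (rule sum.swap)
  also have "\<dots> = (\<Sum>l<k. \<Sum>i<m. \<Sum>j<m. ((A ! l) $$ (i, j))\<^sup>2)"
    by (rule sum.cong[OF refl], rule sum.swap)
  also have "\<dots> = (frob_norm A)\<^sup>2"
    by (simp add: frob_norm_def d sum_nonneg)
  finally show ?thesis by (simp add: c_def)
qed

lemma frob_norm_diag:
  assumes A: "A \<in> tensor_carrier m m k" and U: "ortho_mat (m * k) U"
    and eq: "bcirc A = U * mat_diag (m * k) d * transpose_mat U"
  shows "frob_norm A = 1 / sqrt k * L2_set d {..<m * k}"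
proof -
  have "(\<Sum>i<m * k. (d i)\<^sup>2) = k * (frob_norm A)\<^sup>2"
    using frob_norm_bcirc[OF A] sum_squares_diag_mat[OF U, of d] by (simp add: eq)
  moreover have "0 \<le> frob_norm A" by (simp add: frob_norm_def sum_nonneg)
  ultimately show ?thesis using k by (simp add: L2_set_def real_sqrt_mult)
qed

text \<open>Both norms of a positive semidefinite tensor are functions of the eigenvalues of \<open>bcirc\<close>, up to the
  factor \<open>1 / sqrt k\<close> in the Frobenius case. The two crude bounds on \<open>g\<close> serve the limit
  \<open>p \<rightarrow> \<infinity>\<close>.\<close>

lemma norm_as_spectral_gauge:
  assumes "Nm \<in> {frob_norm, spec_norm}"
  shows "\<exists>g c. spectral_gauge (m * k) g \<and> 0 < c \<and>
    (\<forall>h. (\<forall>i<m * k. 0 \<le> h i) \<longrightarrow> (\<forall>i<m * k. h i \<le> g h) \<and> g h \<le> (\<Sum>i<m * k. h i)) \<and>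
    (\<forall>Y W h. Y \<in> tensor_carrier m m k \<longrightarrow> ortho_mat (m * k) W \<longrightarrow> (\<forall>i<m * k. 0 \<le> h i) \<longrightarrow>
      bcirc Y = W * mat_diag (m * k) h * transpose_mat W \<longrightarrow> Nm Y = c * g h)"
proof -
  have mk: "0 < m * k" using m k by simp
  have nonempty: "{..<m * k} \<noteq> {}" using m k by (auto simp: lessThan_empty_iff)
  consider "Nm = frob_norm" | "Nm = spec_norm" using assms by blast
  then show ?thesis
  proof cases
    case 1
    show ?thesis
    proof (intro exI conjI allI impI)
      show "spectral_gauge (m * k) (\<lambda>d. L2_set d {..<m * k})" by (rule spectral_gauge_L2)
      show "0 < 1 / sqrt k" using k by simp
    next
      fix h :: "nat \<Rightarrow> real" and i assume "\<forall>i<m * k. 0 \<le> h i" "i < m * k"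
      then show "h i \<le> L2_set h {..<m * k}" by (intro member_le_L2_set) auto
    next
      fix h :: "nat \<Rightarrow> real" assume "\<forall>i<m * k. 0 \<le> h i"
      then show "L2_set h {..<m * k} \<le> (\<Sum>i<m * k. h i)" by (intro L2_set_le_sum) auto
    next
      fix Y W h assume "Y \<in> tensor_carrier m m k" "ortho_mat (m * k) W"
        "bcirc Y = W * mat_diag (m * k) h * transpose_mat W"
      then show "Nm Y = 1 / sqrt k * L2_set h {..<m * k}" unfolding 1 by (rule frob_norm_diag)
    qed
  next
    case 2
    show ?thesis
    proof (intro exI conjI allI impI)
      show "spectral_gauge (m * k) (\<lambda>d. Max (d ` {..<m * k}))" by (rule spectral_gauge_Max[OF mk])
      show "0 < (1 :: real)" by simp
    next
      fix h :: "nat \<Rightarrow> real" and i assume "i < m * k"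
      then show "h i \<le> Max (h ` {..<m * k})" by (intro Max_ge) auto
    next
      fix h :: "nat \<Rightarrow> real" assume h: "\<forall>i<m * k. 0 \<le> h i"
      have "Max (h ` {..<m * k}) \<in> h ` {..<m * k}"  by (rule Max_in) (use nonempty in auto)
      then obtain j where "j < m * k" "Max (h ` {..<m * k}) = h j" by auto
      then show "Max (h ` {..<m * k}) \<le> (\<Sum>i<m * k. h i)"
        using h member_le_sum[of j "{..<m * k}" h] by simp
    next
      fix Y W h assume "ortho_mat (m * k) W" "\<forall>i<m * k. 0 \<le> h i"
        "bcirc Y = W * mat_diag (m * k) h * transpose_mat W"
      then show "Nm Y = 1 * Max (h ` {..<m * k})"
        unfolding 2 spec_norm_def by (simp add: mat_spectral_norm_diag[OF mk])
    qed
  qed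
qed

lemma t_abs_powr_diag:
  assumes A: "A \<in> tensor_carrier m m k"
  shows "\<exists>U d. ortho_mat (m * k) U \<and> (\<forall>i<m * k. 0 \<le> d i) \<and>
    (\<forall>x\<in>carrier_vec (m * k). diag_form (m * k) U d x = (bcirc A *\<^sub>v x) \<bullet> (bcirc A *\<^sub>v x)) \<and>
    (\<forall>p. t_abs A powr\<^sub>t p \<in> tensor_carrier m m k \<and>
      bcirc (t_abs A powr\<^sub>t p) = U * mat_diag (m * k) (\<lambda>i. d i powr (p / 2)) * transpose_mat U)"
proof -
  let ?n = "m * k" and ?M = "bcirc A"
  note M = bcirc_carrier[OF A]
  note At = t_transpose_carrier_bcirc[OF A]
  let ?G = "t_transpose A *\<^sub>t A"
  have G: "?G \<in> tensor_carrier m m k" "bcirc ?G = transpose_mat ?M * ?M"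
    using t_prod_carrier_bcirc[OF At(1) A] At(2) by auto
  have "transpose_mat (transpose_mat ?M * ?M) = transpose_mat ?M * ?M"
    using M by (simp add: transpose_mult[of _ ?n ?n _ ?n])
  moreover have "0 \<le> x \<bullet> ((transpose_mat ?M * ?M) *\<^sub>v x)" if "x \<in> carrier_vec ?n" for x
    unfolding gram_quadratic_form[OF M that] by (simp add: scalar_prod_def sum_nonneg)
  moreover have "transpose_mat ?M * ?M \<in> carrier_mat ?n ?n"
    using M by (simp add: mult_carrier_mat[of _ ?n ?n _ ?n])
  ultimately obtain U d where U: "ortho_mat ?n U" and d: "\<And>i. i < ?n \<Longrightarrow> 0 \<le> d i"
    and eq: "transpose_mat ?M * ?M = U * mat_diag ?n d * transpose_mat U"
    using psd_diagonalization by blast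
  have form: "diag_form ?n U d x = (?M *\<^sub>v x) \<bullet> (?M *\<^sub>v x)" if x: "x \<in> carrier_vec ?n" for x
    using gram_quadratic_form[OF M x] unfolding eq quadratic_form_diag[OF U x] .
  have "is_psd_power (bcirc ?G) (1 / 2) (U * mat_diag ?n (\<lambda>i. d i powr (1 / 2)) * transpose_mat U)"
    unfolding G(2) eq by (rule psd_power_of_diag_mat[OF U]) (use d in auto)
  note root = t_powr_carrier_bcirc[OF G(1) this]
  have abs: "t_abs A \<in> tensor_carrier m m k"
    "bcirc (t_abs A) = U * mat_diag ?n (\<lambda>i. d i powr (1 / 2)) * transpose_mat U"
    unfolding t_abs_def by (rule root)+
  have "is_psd_power (bcirc (t_abs A)) p
      (U * mat_diag ?n (\<lambda>i. (d i powr (1 / 2)) powr p) * transpose_mat U)" for p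
    unfolding abs(2) by (rule psd_power_of_diag_mat[OF U]) simp
  then have "is_psd_power (bcirc (t_abs A)) p
      (U * mat_diag ?n (\<lambda>i. d i powr (p / 2)) * transpose_mat U)" for p
    by (simp add: powr_powr)
  note power = t_powr_carrier_bcirc[OF abs(1) this]
  have "t_abs A powr\<^sub>t p \<in> tensor_carrier m m k \<and>
      bcirc (t_abs A powr\<^sub>t p) = U * mat_diag ?n (\<lambda>i. d i powr (p / 2)) * transpose_mat U" for p
    by (intro conjI power)
  then show ?thesis using U d form by blast
qed

text \<open>The decompositions \<open>U, a\<close> and \<open>V, b\<close> are chosen before \<open>p\<close>: in the limit \<open>p \<rightarrow> \<infinity>\<close> the
  eigenvalues of the two moduli have to stay fixed.\<close>

lemma power_sum_norm_eigen:
  assumes A: "A \<in> tensor_carrier m m k" and B: "B \<in> tensor_carrier m m k"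
  shows "\<exists>U a V b. \<forall>p. \<exists>X z W h. power_sum_eigen (m * k) (p / 2) U a V b X z W h \<and>
    (\<forall>x\<in>carrier_vec (m * k). diag_form (m * k) X z x =
      (bcirc A *\<^sub>v x) \<bullet> (bcirc A *\<^sub>v x) + (bcirc B *\<^sub>v x) \<bullet> (bcirc B *\<^sub>v x)) \<and>
    t_abs A powr\<^sub>t p +\<^sub>t t_abs B powr\<^sub>t p \<in> tensor_carrier m m k \<and>
    bcirc (t_abs A powr\<^sub>t p +\<^sub>t t_abs B powr\<^sub>t p) = W * mat_diag (m * k) h * transpose_mat W"
proof -
  let ?n = "m * k"
  obtain U a where U: "ortho_mat ?n U" "\<forall>i<?n. 0 \<le> a i"
    and Uf: "\<And>x. x \<in> carrier_vec ?n \<Longrightarrow> diag_form ?n U a x = (bcirc A *\<^sub>v x) \<bullet> (bcirc A *\<^sub>v x)"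
    and UA: "\<And>p. t_abs A powr\<^sub>t p \<in> tensor_carrier m m k"
      "\<And>p. bcirc (t_abs A powr\<^sub>t p) = U * mat_diag ?n (\<lambda>i. a i powr (p / 2)) * transpose_mat U"
    using t_abs_powr_diag[OF A] by blast
  obtain V b where V: "ortho_mat ?n V" "\<forall>i<?n. 0 \<le> b i"
    and Vf: "\<And>x. x \<in> carrier_vec ?n \<Longrightarrow> diag_form ?n V b x = (bcirc B *\<^sub>v x) \<bullet> (bcirc B *\<^sub>v x)"
    and VB: "\<And>p. t_abs B powr\<^sub>t p \<in> tensor_carrier m m k"
      "\<And>p. bcirc (t_abs B powr\<^sub>t p) = V * mat_diag ?n (\<lambda>i. b i powr (p / 2)) * transpose_mat V"
    using t_abs_powr_diag[OF B] by blast
  obtain X z where X: "ortho_mat ?n X" "\<forall>i<?n. 0 \<le> z i"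
    "\<forall>x\<in>carrier_vec ?n. diag_form ?n X z x = diag_form ?n U a x + diag_form ?n V b x"
    using diag_mat_sum_diagonalization[OF U V] by blast
  show ?thesis
  proof (rule exI[of _ U], rule exI[of _ a], rule exI[of _ V], rule exI[of _ b], rule allI)
    fix p :: real
    let ?a = "\<lambda>i. a i powr (p / 2)" and ?b = "\<lambda>i. b i powr (p / 2)"
    obtain W h where W: "ortho_mat ?n W" "\<forall>i<?n. 0 \<le> h i"
      "\<forall>x\<in>carrier_vec ?n. diag_form ?n W h x = diag_form ?n U ?a x + diag_form ?n V ?b x"
      and Weq: "U * mat_diag ?n ?a * transpose_mat U + V * mat_diag ?n ?b * transpose_mat V
        = W * mat_diag ?n h * transpose_mat W"
      using diag_mat_sum_diagonalization[OF U(1) _ V(1), of ?a ?b] by auto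
    have "power_sum_eigen ?n (p / 2) U a V b X z W h"
      unfolding power_sum_eigen_def using U V X W by blast
    then show "\<exists>X z W h. power_sum_eigen ?n (p / 2) U a V b X z W h \<and>
      (\<forall>x\<in>carrier_vec ?n. diag_form ?n X z x =
        (bcirc A *\<^sub>v x) \<bullet> (bcirc A *\<^sub>v x) + (bcirc B *\<^sub>v x) \<bullet> (bcirc B *\<^sub>v x)) \<and>
      t_abs A powr\<^sub>t p +\<^sub>t t_abs B powr\<^sub>t p \<in> tensor_carrier m m k \<and>
      bcirc (t_abs A powr\<^sub>t p +\<^sub>t t_abs B powr\<^sub>t p) = W * mat_diag ?n h * transpose_mat W"
      using t_add_carrier_bcirc[OF UA(1) VB(1), of p p] X(3) Uf Vf Weq UA(2) VB(2)
      by (intro exI[of _ X] exI[of _ z] exI[of _ W] exI[of _ h]) simp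
  qed
qed

theorem power_sum_norm_triangle:
  assumes Nm: "Nm \<in> {frob_norm, spec_norm}" and p: "1 \<le> p"
    and A1: "A1 \<in> tensor_carrier m m k" and A2: "A2 \<in> tensor_carrier m m k"
    and B1: "B1 \<in> tensor_carrier m m k" and B2: "B2 \<in> tensor_carrier m m k"
  shows "2 powr (- \<bar>1 / p - 1 / 2\<bar>) * power_sum_norm Nm p (A1 +\<^sub>t A2) (B1 +\<^sub>t B2)
    \<le> power_sum_norm Nm p A1 B1 + power_sum_norm Nm p A2 B2"
proof -
  let ?n = "m * k"
  obtain g c where g: "spectral_gauge ?n g" and c: "0 < c"
    and Nm_eq: "\<And>Y W h. \<lbrakk>Y \<in> tensor_carrier m m k; ortho_mat ?n W; \<forall>i<?n. 0 \<le> h i;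
      bcirc Y = W * mat_diag ?n h * transpose_mat W\<rbrakk> \<Longrightarrow> Nm Y = c * g h"
    using norm_as_spectral_gauge[OF Nm] by blast
  have eig: "\<exists>U a V b X z W h. power_sum_eigen ?n (p / 2) U a V b X z W h \<and>
      (\<forall>x\<in>carrier_vec ?n. diag_form ?n X z x =
        (bcirc A *\<^sub>v x) \<bullet> (bcirc A *\<^sub>v x) + (bcirc B *\<^sub>v x) \<bullet> (bcirc B *\<^sub>v x)) \<and>
      power_sum_norm Nm p A B = c powr (1 / p) * g h powr (1 / p)"
    if AB: "A \<in> tensor_carrier m m k" "B \<in> tensor_carrier m m k" for A B
  proof -
    obtain U a V b X z W h where H: "power_sum_eigen ?n (p / 2) U a V b X z W h"
      and form: "\<forall>x\<in>carrier_vec ?n. diag_form ?n X z x =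
        (bcirc A *\<^sub>v x) \<bullet> (bcirc A *\<^sub>v x) + (bcirc B *\<^sub>v x) \<bullet> (bcirc B *\<^sub>v x)"
      and Y: "t_abs A powr\<^sub>t p +\<^sub>t t_abs B powr\<^sub>t p \<in> tensor_carrier m m k"
        "bcirc (t_abs A powr\<^sub>t p +\<^sub>t t_abs B powr\<^sub>t p) = W * mat_diag ?n h * transpose_mat W"
      using power_sum_norm_eigen[OF AB] by blast
    note D = power_sum_eigenD[OF H]
    have "Nm (t_abs A powr\<^sub>t p +\<^sub>t t_abs B powr\<^sub>t p) = c * g h"
      by (rule Nm_eq[OF Y(1) D(4) _ Y(2)]) (use D(8) in blast)
    moreover have "0 \<le> g h" using spectral_gauge.nonneg[OF g, of h] D(8) by blast
    ultimately have "power_sum_norm Nm p A B = c powr (1 / p) * g h powr (1 / p)"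
      using c by (simp add: power_sum_norm_def powr_mult)
    then show ?thesis using H form by blast
  qed
  note sA = t_add_carrier_bcirc[OF A1 A2] and sB = t_add_carrier_bcirc[OF B1 B2]
  obtain U a V b X z W h where H: "power_sum_eigen ?n (p / 2) U a V b X z W h"
    and z: "\<forall>x\<in>carrier_vec ?n. diag_form ?n X z x =
      ((bcirc A1 + bcirc A2) *\<^sub>v x) \<bullet> ((bcirc A1 + bcirc A2) *\<^sub>v x)
      + ((bcirc B1 + bcirc B2) *\<^sub>v x) \<bullet> ((bcirc B1 + bcirc B2) *\<^sub>v x)"
    and N: "power_sum_norm Nm p (A1 +\<^sub>t A2) (B1 +\<^sub>t B2) = c powr (1 / p) * g h powr (1 / p)"
    using eig[OF sA(1) sB(1)] unfolding sA(2) sB(2) by blast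
  obtain U1 a1 V1 b1 X1 z1 W1 h1 where H1: "power_sum_eigen ?n (p / 2) U1 a1 V1 b1 X1 z1 W1 h1"
    and z1: "\<forall>x\<in>carrier_vec ?n. diag_form ?n X1 z1 x =
      (bcirc A1 *\<^sub>v x) \<bullet> (bcirc A1 *\<^sub>v x) + (bcirc B1 *\<^sub>v x) \<bullet> (bcirc B1 *\<^sub>v x)"
    and N1: "power_sum_norm Nm p A1 B1 = c powr (1 / p) * g h1 powr (1 / p)"
    using eig[OF A1 B1] by blast
  obtain U2 a2 V2 b2 X2 z2 W2 h2 where H2: "power_sum_eigen ?n (p / 2) U2 a2 V2 b2 X2 z2 W2 h2"
    and z2: "\<forall>x\<in>carrier_vec ?n. diag_form ?n X2 z2 x =
      (bcirc A2 *\<^sub>v x) \<bullet> (bcirc A2 *\<^sub>v x) + (bcirc B2 *\<^sub>v x) \<bullet> (bcirc B2 *\<^sub>v x)"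
    and N2: "power_sum_norm Nm p A2 B2 = c powr (1 / p) * g h2 powr (1 / p)"
    using eig[OF A2 B2] by blast
  have "2 powr (- \<bar>1 / p - 1 / 2\<bar>) * g h powr (1 / p) \<le> g h1 powr (1 / p) + g h2 powr (1 / p)"
  proof (rule spectral_gauge.power_sum_triangle[OF g H H1 H2 _ p])
    fix x :: "real vec" assume x: "x \<in> carrier_vec ?n"
    show "sqrt (diag_form ?n X z x) \<le> sqrt (diag_form ?n X1 z1 x) + sqrt (diag_form ?n X2 z2 x)"
      using stacked_norm_triangle[OF bcirc_carrier[OF A1] bcirc_carrier[OF A2]
          bcirc_carrier[OF B1] bcirc_carrier[OF B2] x] z z1 z2 x by simp
  qed
  then have "c powr (1 / p) * (2 powr (- \<bar>1 / p - 1 / 2\<bar>) * g h powr (1 / p))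
      \<le> c powr (1 / p) * (g h1 powr (1 / p) + g h2 powr (1 / p))"
    by (rule mult_left_mono) simp
  then show ?thesis unfolding N N1 N2 by (simp add: algebra_simps)
qed

text \<open>If \<open>K\<close> is the largest squared singular value of the two matrices, then the norm of the power sum
  lies between constant multiples of \<open>K\<^bsup>q/2\<^esup>\<close>, so its \<open>q\<close>-th root tends to the square root of \<open>K\<close>.\<close>

lemma power_sum_norm_tendsto:
  assumes Nm: "Nm \<in> {frob_norm, spec_norm}"
    and A: "A \<in> tensor_carrier m m k" and B: "B \<in> tensor_carrier m m k"
  shows "\<exists>L. ((\<lambda>q. power_sum_norm Nm q A B) \<longlongrightarrow> L) at_top"
proof -
  let ?n = "m * k"
  have n: "{..<?n} \<noteq> {}" using m k by (auto simp: lessThan_empty_iff)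
  obtain g c where c: "0 < c"
    and g: "\<And>h. \<forall>i<?n. 0 \<le> h i \<Longrightarrow> (\<forall>i<?n. h i \<le> g h) \<and> g h \<le> (\<Sum>i<?n. h i)"
    and Nm_eq: "\<And>Y W h. \<lbrakk>Y \<in> tensor_carrier m m k; ortho_mat ?n W; \<forall>i<?n. 0 \<le> h i;
      bcirc Y = W * mat_diag ?n h * transpose_mat W\<rbrakk> \<Longrightarrow> Nm Y = c * g h"
    using norm_as_spectral_gauge[OF Nm] by blast
  obtain U a V b where eig: "\<forall>q. \<exists>X z W h. power_sum_eigen ?n (q / 2) U a V b X z W h \<and>
      (\<forall>x\<in>carrier_vec ?n. diag_form ?n X z x =
        (bcirc A *\<^sub>v x) \<bullet> (bcirc A *\<^sub>v x) + (bcirc B *\<^sub>v x) \<bullet> (bcirc B *\<^sub>v x)) \<and>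
      t_abs A powr\<^sub>t q +\<^sub>t t_abs B powr\<^sub>t q \<in> tensor_carrier m m k \<and>
      bcirc (t_abs A powr\<^sub>t q +\<^sub>t t_abs B powr\<^sub>t q) = W * mat_diag ?n h * transpose_mat W"
    using power_sum_norm_eigen[OF A B] by blast
  obtain X' z' W' h' where H': "power_sum_eigen ?n (1 / 2) U a V b X' z' W' h'"
    using spec[OF eig, of 1] by blast
  note UV = power_sum_eigenD(1,2,5,6)[OF H']
  define K where "K = Max (a ` {..<?n} \<union> b ` {..<?n})"
  have K_ge: "a i \<le> K" "b i \<le> K" if "i < ?n" for i
    unfolding K_def using that by (auto intro!: Max_ge)
  have "K \<in> a ` {..<?n} \<union> b ` {..<?n}" unfolding K_def by (rule Max_in) (use n in auto)
  then obtain j where j: "j < ?n" "K = a j \<or> K = b j" by auto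
  have K0: "0 \<le> K" using j UV by auto
  have sandwich: "c powr (1 / q) * K powr (1 / 2) \<le> power_sum_norm Nm q A B \<and>
      power_sum_norm Nm q A B \<le> (c * (2 * real ?n)) powr (1 / q) * K powr (1 / 2)" if q: "0 < q" for q
  proof -
    obtain X z W h where H: "power_sum_eigen ?n (q / 2) U a V b X z W h"
      and Y: "t_abs A powr\<^sub>t q +\<^sub>t t_abs B powr\<^sub>t q \<in> tensor_carrier m m k"
        "bcirc (t_abs A powr\<^sub>t q +\<^sub>t t_abs B powr\<^sub>t q) = W * mat_diag ?n h * transpose_mat W"
      using spec[OF eig, of q] by blast
    note D = power_sum_eigenD[OF H]
    have h0: "\<forall>i<?n. 0 \<le> h i" using D(8) by blast
    let ?a = "\<lambda>i. a i powr (q / 2)" and ?b = "\<lambda>i. b i powr (q / 2)"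
    have N: "power_sum_norm Nm q A B = (c * g h) powr (1 / q)"
      unfolding power_sum_norm_def Nm_eq[OF Y(1) D(4) h0 Y(2)] ..
    have C0: "0 \<le> c * (2 * real ?n)" using c by simp
    have root: "(C * K powr (q / 2)) powr (1 / q) = C powr (1 / q) * K powr (1 / 2)" if "0 \<le> C" for C
      using that q by (simp add: powr_mult powr_powr)
    have "h i \<le> 2 * K powr (q / 2)" if i: "i < ?n" for i
    proof -
      note x = col_carrier_ortho[OF D(4) i]
      have xx: "col W i \<bullet> col W i = 1" using col_scalar_prod_ortho[OF D(4) i i] by simp
      have "h i = diag_form ?n U ?a (col W i) + diag_form ?n V ?b (col W i)"
        using D(10)[OF x] diag_form_own_col[OF D(4) i, of h] by simp
      also have "\<dots> \<le> diag_form ?n U (\<lambda>_. K powr (q / 2)) (col W i) + diag_form ?n V (\<lambda>_. K powr (q / 2)) (col W i)"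
        by (intro add_mono diag_form_mono powr_mono2) (use K_ge UV q in auto)
      also have "\<dots> = 2 * K powr (q / 2)"
        by (simp add: diag_form_const[OF UV(1) x] diag_form_const[OF UV(2) x] xx)
      finally show ?thesis .
    qed
    then have "(\<Sum>i<?n. h i) \<le> (\<Sum>i<?n. 2 * K powr (q / 2))" by (intro sum_mono) simp
    then have "g h \<le> (2 * real ?n) * K powr (q / 2)"
      using g[OF h0] by (simp add: mult.commute mult.left_commute)
    then have up: "c * g h \<le> c * (2 * real ?n) * K powr (q / 2)"
      unfolding mult.assoc[of c] using c by (intro mult_left_mono) auto
    have "K powr (q / 2) \<le> g h"
    proof -
      have W_le: "diag_form ?n W h x \<le> g h" if "x \<in> carrier_vec ?n" "x \<bullet> x = 1" for x
        using diag_form_mono[of ?n h "\<lambda>_. g h" W x] g[OF h0] that by (simp add: diag_form_const[OF D(4)])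
      show ?thesis
        using j(2)
      proof
        assume K: "K = a j"
        note x = col_carrier_ortho[OF D(1) j(1)]
        have "K powr (q / 2) \<le> diag_form ?n W h (col U j)"
          using D(10)[OF x] diag_form_own_col[OF D(1) j(1), of ?a] diag_form_nonneg[of ?n ?b V "col U j"]
          by (simp add: K)
        also have "\<dots> \<le> g h" by (rule W_le[OF x]) (simp add: col_scalar_prod_ortho[OF D(1) j(1) j(1)])
        finally show ?thesis .
      next
        assume K: "K = b j"
        note x = col_carrier_ortho[OF D(2) j(1)]
        have "K powr (q / 2) \<le> diag_form ?n W h (col V j)"
          using D(10)[OF x] diag_form_own_col[OF D(2) j(1), of ?b] diag_form_nonneg[of ?n ?a U "col V j"]
          by (simp add: K)
        also have "\<dots> \<le> g h" by (rule W_le[OF x]) (simp add: col_scalar_prod_ortho[OF D(2) j(1) j(1)])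
        finally show ?thesis .
      qed
    qed
    then have lo: "c * K powr (q / 2) \<le> c * g h" using c by simp
    have "0 \<le> c * K powr (q / 2)" using c by simp
    from powr_mono2[OF _ this lo, of "1 / q"] powr_mono2[OF _ order_trans[OF this lo] up, of "1 / q"]
    show ?thesis
      unfolding N root[OF less_imp_le[OF c], symmetric] root[OF C0, symmetric] using q by simp
  qed
  have lim: "((\<lambda>q. C powr (1 / q) * K powr (1 / 2)) \<longlongrightarrow> C powr 0 * K powr (1 / 2)) at_top"
    if "0 < C" for C :: real
  proof -
    have "((\<lambda>q::real. 1 / q) \<longlongrightarrow> 0) at_top"
      by (intro tendsto_divide_0[OF tendsto_const] filterlim_at_top_imp_at_infinity filterlim_ident)
    from tendsto_powr[OF tendsto_const this, of C] that show ?thesis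
      by (intro tendsto_mult tendsto_const) simp
  qed
  have "((\<lambda>q. power_sum_norm Nm q A B) \<longlongrightarrow> K powr (1 / 2)) at_top"
  proof (rule tendsto_sandwich)
    show "\<forall>\<^sub>F q in at_top. c powr (1 / q) * K powr (1 / 2) \<le> power_sum_norm Nm q A B"
      using eventually_gt_at_top[of 0] by eventually_elim (rule sandwich[THEN conjunct1])
    show "\<forall>\<^sub>F q in at_top. power_sum_norm Nm q A B \<le> (c * (2 * real ?n)) powr (1 / q) * K powr (1 / 2)"
      using eventually_gt_at_top[of 0] by eventually_elim (rule sandwich[THEN conjunct2])
    show "((\<lambda>q. c powr (1 / q) * K powr (1 / 2)) \<longlongrightarrow> K powr (1 / 2)) at_top"
      using lim[OF c] c by simp
    show "((\<lambda>q. (c * (2 * real ?n)) powr (1 / q) * K powr (1 / 2)) \<longlongrightarrow> K powr (1 / 2)) at_top"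
      using lim[of "c * (2 * real ?n)"] c m k by simp
  qed
  then show ?thesis by blast
qed

end

section \<open>The triangle inequality for tensors\<close>

theorem theorem4p6:
  fixes n1 n3 :: nat and p :: ereal and A1 A2 B1 B2 :: tensor
  assumes "n1 > 0" and "n3 > 0" and "1 \<le> p"
    and "A1 \<in> tensor_carrier n1 n1 n3" and "A2 \<in> tensor_carrier n1 n1 n3"
    and "B1 \<in> tensor_carrier n1 n1 n3" and "B2 \<in> tensor_carrier n1 n1 n3"
  shows "\<forall>N \<in> {frob_norm, spec_norm}.
    2 powr (- \<bar>real_of_ereal (1 / p) - 1 / 2\<bar>) * power_sum_norm_ext N p (A1 +\<^sub>t A2) (B1 +\<^sub>t B2)
      \<le> power_sum_norm_ext N p A1 B1 + power_sum_norm_ext N p A2 B2"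
proof
  fix N assume N: "N \<in> {frob_norm, spec_norm}"
  interpret block_format n1 n3 by unfold_locales (use assms in auto)
  note T = assms(4-7)
  show "2 powr (- \<bar>real_of_ereal (1 / p) - 1 / 2\<bar>) * power_sum_norm_ext N p (A1 +\<^sub>t A2) (B1 +\<^sub>t B2)
      \<le> power_sum_norm_ext N p A1 B1 + power_sum_norm_ext N p A2 B2"
  proof (cases p)
    case (real q)
    then have q: "1 \<le> q" using assms(3) by simp
    moreover have "1 / p = ereal (1 / q)"
      unfolding real one_ereal_def using \<open>1 \<le> q\<close> by (subst ereal_divide) auto
    ultimately show ?thesis
      using power_sum_norm_triangle[OF N _ T(1,2,3,4), of q] by (simp add: power_sum_norm_ext_def real)
  next
    case PInf
    have lim: "((\<lambda>q. power_sum_norm N q A B) \<longlongrightarrow> power_sum_norm_ext N p A B) at_top"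
      if AB: "A \<in> tensor_carrier n1 n1 n3" "B \<in> tensor_carrier n1 n1 n3" for A B
    proof -
      obtain L where L: "((\<lambda>q. power_sum_norm N q A B) \<longlongrightarrow> L) at_top"
        using power_sum_norm_tendsto[OF N AB] by blast
      then have "Lim at_top (\<lambda>q. power_sum_norm N q A B) = L" by (intro tendsto_Lim) auto
      then show ?thesis using L by (simp add: power_sum_norm_ext_def PInf)
    qed
    have recip: "((\<lambda>q::real. 1 / q) \<longlongrightarrow> 0) at_top"
      by (intro tendsto_divide_0[OF tendsto_const] filterlim_at_top_imp_at_infinity filterlim_ident)
    have const: "((\<lambda>q::real. 2 powr (- \<bar>1 / q - 1 / 2\<bar>)) \<longlongrightarrow> (2::real) powr (- \<bar>0 - 1 / 2\<bar>)) at_top"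
      by (intro tendsto_intros recip) auto
    have "2 powr (- \<bar>0 - 1 / 2\<bar>) * power_sum_norm_ext N p (A1 +\<^sub>t A2) (B1 +\<^sub>t B2)
      \<le> power_sum_norm_ext N p A1 B1 + power_sum_norm_ext N p A2 B2"
    proof (rule tendsto_le)
      show "((\<lambda>q. 2 powr (- \<bar>1 / q - 1 / 2\<bar>) * power_sum_norm N q (A1 +\<^sub>t A2) (B1 +\<^sub>t B2))
          \<longlongrightarrow> 2 powr (- \<bar>0 - 1 / 2\<bar>) * power_sum_norm_ext N p (A1 +\<^sub>t A2) (B1 +\<^sub>t B2)) at_top"
        by (intro tendsto_mult const lim t_add_carrier_bcirc T)
      show "((\<lambda>q. power_sum_norm N q A1 B1 + power_sum_norm N q A2 B2)
          \<longlongrightarrow> power_sum_norm_ext N p A1 B1 + power_sum_norm_ext N p A2 B2) at_top"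
        by (intro tendsto_add lim T)
      show "\<forall>\<^sub>F q in at_top. 2 powr (- \<bar>1 / q - 1 / 2\<bar>) * power_sum_norm N q (A1 +\<^sub>t A2) (B1 +\<^sub>t B2)
          \<le> power_sum_norm N q A1 B1 + power_sum_norm N q A2 B2"
        using eventually_ge_at_top[of 1]
        by eventually_elim (rule power_sum_norm_triangle[OF N _ T])
    qed simp
    then show ?thesis by (simp add: PInf)
  next
    case MInf
    then show ?thesis using assms(3) by simp
  qed
qed

end
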